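(* Let $\delta\in(0,1)$, and suppose the (fixed) offline meta-trained parameters $w$, $\bar\theta_0\in\mathbb{R}^d$ and $\Lambda_0\in\mathbb{R}^{d\times d}$ (symmetric positive definite) satisfy the following two assumptions. (Assumption 1) For all $\xi\sim p(\xi)$ there exists $\theta^*_\xi\in\mathbb{R}^d$ such that ${\theta^*_\xi}^\top\phi_w(z)=h_{\mathrm{IS}}(z;\xi)$ for all $z\in\mathbb{R}^2$. (Assumption 2) For $\xi\sim p(\xi)$, $\mathbb{P}\big(\|\theta^*_\xi-\bar\theta_0\|_{\Lambda_0}^2\le \sigma^2\mathcal{X}_d^2(1-\delta)\big)\ge 1-\delta$. Let $\xi\sim p(\xi)$ be a new environment, let $D_\xi=\{(z_i,y_i)\}_{i=1}^{N}$ be data from it, and let $$\Lambda_\xi=\Phi_\xi^\top\Phi_\xi+\Lambda_0,\qquad \bar\theta_\xi=\Lambda_\xi^{-1}(\Phi_\xi^\top G_\xi+\Lambda_0\bar\theta_0),$$ where $\Phi_\xi^\top=[\phi_w(z_1),\dots,\phi_w(z_N)]\in\mathbb{R}^{d\times N}$ and $G_\xi^\top=[y_1,\dots,y_N]$. Let $\bar h_{\mathrm{IS}}(z;\theta_\xi)=\bar\theta_\xi^\top\phi_w(z)$ be the mean prediction. Then, with probability at least $1-2\delta$ (over the draw of $\xi$ and the measurement noise), for all $z\in\mathbb{R}^2$, $$|h_{\mathrm{IS}}(z;\xi)-\bar h_{\mathrm{IS}}(z;\theta_\xi)|\le |\phi_w(z)^\top(\bar\theta_\xi-\theta^*_\xi)|\le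 \|\phi_w(z)\|_{\Lambda_\xi^{-1}}\,\beta_\xi,$$ where $$\beta_\xi=\sigma\left(\sqrt{2\log\left(\frac{1}{\delta}\frac{\det(\Lambda_\xi)^{1/2}}{\det(\Lambda_0)^{1/2}}\right)}+\sqrt{\frac{\bar\lambda(\Lambda_0)}{\underline\lambda(\Lambda_\xi)}\mathcal{X}_d^2(1-\delta)}\right).$$
   Context: $\xi$ is an unobserved latent random variable with distribution $p(\xi)$, encoding the geometry (position, shape) of an obstacle in the plane. For each $\xi$, $h_{\mathrm{IS}}(\cdot;\xi):\mathbb{R}^2\to\mathbb{R}$ is the implicit surface function of the obstacle: $h_{\mathrm{IS}}(z;\xi)=d_\xi(z)$ if $z$ is outside the obstacle, $0$ if $z$ is on its surface, and $-d_\xi(z)$ if $z$ is inside, where $d_\xi(z)\ge 0$ is the minimum Euclidean distance from $z$ to the surface. $\phi_w:\mathbb{R}^2\to\mathbb{R}^d$ is a fixed feature map (a feed-forward neural network with parameter $w$). The function $h_{\mathrm{IS}}$ is modelled by $\theta^\top\phi_w(z)$ with prior $\theta\sim\mathcal{N}(\bar\theta_0,\sigma^2\Lambda_0^{-1})$; $\bar\theta_\xi,\Lambda_\xi$ are the parameters of the posterior $\theta_\xi\sim\mathcal{N}(\bar\theta_\xi,\sigma^2\Lambda_\xi^{-1})$ given by Bayesian linear regression. Data model: $y_i=h_{\mathrm{IS}}(z_i;\xi)+\varsigma_i$, $i=1,\dots,N$, where the noise terms $\varsigma_i$ are bounded and $\sigma$-subgaussian with $\sigma>0$, meaning that conditionally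 on $\xi$, $z_1,\dots,z_i$ and $\varsigma_1,\dots,\varsigma_{i-1}$ one has $\mathbb{E}[e^{s\varsigma_i}\mid\cdot]\le e^{s^2\sigma^2/2}$ for all $s\in\mathbb{R}$. Notation: $\|a\|_M=\sqrt{a^\top M a}$ for positive definite $M$; $\bar\lambda(M)$ and $\underline\lambda(M)$ are the maximum and minimum eigenvalues of $M$; $\mathcal{X}_d^2(p)$ is the $p$-th quantile of the chi-squared distribution with $d$ degrees of freedom. *)

theory Defs
  imports "HOL-Probability.Probability"
begin

definition surface :: "(real^2) set \<Rightarrow> (real^2) set" where
  "surface K = frontier K"

definition h_IS :: "(real^2) set \<Rightarrow> real^2 \<Rightarrow> real" where
  "h_IS K z =
    (if z \<in> surface K then 0
     else if z \<in> interior K then - infdist z (surface K)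
     else infdist z (surface K))"

definition pos_def :: "real^'d^'d \<Rightarrow> bool" where
  "pos_def A \<longleftrightarrow> transpose A = A \<and> (\<forall>v. v \<noteq> 0 \<longrightarrow> v \<bullet> (A *v v) > 0)"

definition wnorm :: "real^'d^'d \<Rightarrow> real^'d \<Rightarrow> real" where
  "wnorm A v = sqrt (v \<bullet> (A *v v))"

definition eigenvals :: "real^'d^'d \<Rightarrow> real set" where
  "eigenvals A = {l. \<exists>v. v \<noteq> 0 \<and> A *v v = l *\<^sub>R v}"

definition max_eig :: "real^'d^'d \<Rightarrow> real" where
  "max_eig A = Max (eigenvals A)"

definition min_eig :: "real^'d^'d \<Rightarrow> real" where
  "min_eig A = Min (eigenvals A)"

definition chi_squared :: "nat \<Rightarrow> real measure" where
  "chi_squared d =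
    distr (\<Pi>\<^sub>M i\<in>{..<d}. density lborel (\<lambda>x. ennreal (std_normal_density x))) borel
      (\<lambda>x. \<Sum>i<d. (x i)\<^sup>2)"

definition quantile :: "real measure \<Rightarrow> real \<Rightarrow> real" where
  "quantile D q = Inf {x. q \<le> cdf D x}"

(* Samples are indexed by an arbitrary finite linearly ordered type 'n, so that N = CARD('n);
   the order is the order in which the data are collected. *)

definition design_matrix :: "(real^2 \<Rightarrow> real^'d) \<Rightarrow> ('n \<Rightarrow> real^2) \<Rightarrow> real^'d^'n" where
  "design_matrix f z = (\<chi> i. f (z i))"

definition post_precision ::
    "(real^2 \<Rightarrow> real^'d) \<Rightarrow> real^'d^'d \<Rightarrow> ('n::finite \<Rightarrow> real^2) \<Rightarrow> real^'d^'d" where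
  "post_precision f \<Lambda>\<^sub>0 z = transpose (design_matrix f z) ** design_matrix f z + \<Lambda>\<^sub>0"

definition post_mean ::
    "(real^2 \<Rightarrow> real^'d) \<Rightarrow> real^'d^'d \<Rightarrow> real^'d \<Rightarrow> ('n::finite \<Rightarrow> real^2) \<Rightarrow> ('n \<Rightarrow> real) \<Rightarrow> real^'d" where
  "post_mean f \<Lambda>\<^sub>0 \<theta>\<^sub>0 z y =
    matrix_inv (post_precision f \<Lambda>\<^sub>0 z) *v
      (transpose (design_matrix f z) *v (\<chi> i. y i) + \<Lambda>\<^sub>0 *v \<theta>\<^sub>0)"

definition mean_prediction :: "(real^2 \<Rightarrow> real^'d) \<Rightarrow> real^'d \<Rightarrow> real^2 \<Rightarrow> real" where
  "mean_prediction f \<theta> z = \<theta> \<bullet> f z"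

definition conf_radius ::
    "(real^2 \<Rightarrow> real^'d) \<Rightarrow> real^'d^'d \<Rightarrow> real \<Rightarrow> real \<Rightarrow> ('n::finite \<Rightarrow> real^2) \<Rightarrow> real" where
  "conf_radius f \<Lambda>\<^sub>0 \<sigma> \<delta> z =
    \<sigma> * (sqrt (2 * ln (1 / \<delta> * (sqrt (det (post_precision f \<Lambda>\<^sub>0 z)) / sqrt (det \<Lambda>\<^sub>0))))
       + sqrt (max_eig \<Lambda>\<^sub>0 / min_eig (post_precision f \<Lambda>\<^sub>0 z)
               * quantile (chi_squared CARD('d)) (1 - \<delta>)))"

(* The sigma-algebra generated by the environment, the inputs up to and including i,
   and the noise terms strictly before i. *)
definition history ::
    "'a measure \<Rightarrow> 'e measure \<Rightarrow> ('a \<Rightarrow> 'e) \<Rightarrow> ('n::linorder \<Rightarrow> 'a \<Rightarrow> real^2) \<Rightarrow>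
     ('n \<Rightarrow> 'a \<Rightarrow> real) \<Rightarrow> 'n \<Rightarrow> 'a measure" where
  "history M p \<xi> z \<epsilon> i =
    vimage_algebra (space M)
      (\<lambda>\<omega>. (\<xi> \<omega>, \<lambda>j\<in>{..i}. z j \<omega>, \<lambda>j\<in>{..<i}. \<epsilon> j \<omega>))
      (p \<Otimes>\<^sub>M ((\<Pi>\<^sub>M j\<in>{..i}. borel) \<Otimes>\<^sub>M (\<Pi>\<^sub>M j\<in>{..<i}. borel)))"

definition bounded_subgaussian_noise ::
    "'a measure \<Rightarrow> 'e measure \<Rightarrow> ('a \<Rightarrow> 'e) \<Rightarrow> ('n::linorder \<Rightarrow> 'a \<Rightarrow> real^2) \<Rightarrow>
     ('n \<Rightarrow> 'a \<Rightarrow> real) \<Rightarrow> real \<Rightarrow> bool" where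
  "bounded_subgaussian_noise M p \<xi> z \<epsilon> \<sigma> \<longleftrightarrow>
    (\<forall>i. \<exists>B. AE \<omega> in M. \<bar>\<epsilon> i \<omega>\<bar> \<le> B) \<and>
    (\<forall>i s. AE \<omega> in M.
      real_cond_exp M (history M p \<xi> z \<epsilon> i) (\<lambda>\<omega>. exp (s * \<epsilon> i \<omega>)) \<omega> \<le> exp (s\<^sup>2 * \<sigma>\<^sup>2 / 2))"

end

theory Submission
  imports Defs
begin

text \<open>
  Writing \<open>S\<close> for the sum of the terms \<open>\<epsilon>\<^sub>i \<phi>(z\<^sub>i)\<close>, the error of the posterior mean is
  \<open>\<Lambda>\<^sub>\<xi>\<^sup>-\<^sup>1 (S + \<Lambda>\<^sub>0 (\<theta>\<^sub>0 - \<theta>\<^sup>*))\<close>, so Cauchy-Schwarz in the \<open>\<Lambda>\<^sub>\<xi>\<^sup>-\<^sup>1\<close> inner product reduces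
  the claim to bounds on \<open>S\<close> and on \<open>\<Lambda>\<^sub>0 (\<theta>\<^sub>0 - \<theta>\<^sup>*)\<close> in that norm. The second follows from
  Assumption 2 and extremal eigenvalues. The first is the self-normalised bound obtained by the
  method of mixtures: for each \<open>x\<close> the exponential
  \<open>exp (x \<bullet> S / \<sigma> - \<Sum>\<^sub>i (x \<bullet> \<phi>(z\<^sub>i))\<^sup>2 / 2)\<close> has expectation at most 1, integrating it against the
  unnormalised Gaussian \<open>exp (- x \<bullet> \<Lambda>\<^sub>0 x / 2)\<close> and exchanging the integrals gives an explicit
  random variable of bounded expectation, and Markov's inequality finishes the argument.
\<close>

subsection \<open>Linear change of variables for Lebesgue measure\<close>

text \<open>Tonelli with one coordinate singled out: \<open>lborel\<close> is the image of a product
  measure over \<open>Basis\<close>, and the coordinate along \<open>axis m 1\<close> becomes the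
  inner integral.\<close>

lemma nn_integral_lborel_coordinate:
  fixes g :: "real^'n \<Rightarrow> ennreal" and m :: 'n
  assumes [measurable]: "g \<in> borel_measurable borel"
  shows "(\<integral>\<^sup>+x. g x \<partial>lborel) =
    (\<integral>\<^sup>+f. (\<integral>\<^sup>+t. g (\<Sum>b\<in>Basis. (f(axis m 1 := t)) b *\<^sub>R b) \<partial>lborel) \<partial>(\<Pi>\<^sub>M b\<in>Basis - {axis m 1 :: real^'n}. lborel))"
proof -
  interpret product_sigma_finite "\<lambda>_::real^'n. lborel :: real measure"
    by standard
  have ax: "axis m (1::real) \<in> Basis" by simp
  have eq: "insert (axis m (1::real)) (Basis - {axis m 1}) = Basis" using ax by blast
  have "(\<integral>\<^sup>+x. g x \<partial>lborel) = (\<integral>\<^sup>+f. g (\<Sum>b\<in>Basis. f b *\<^sub>R b) \<partial>(\<Pi>\<^sub>M b\<in>Basis. lborel))"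
    by (subst lborel_eq) (simp add: nn_integral_distr)
  also have "\<dots> = (\<integral>\<^sup>+f. g (\<Sum>b\<in>Basis. f b *\<^sub>R b) \<partial>(\<Pi>\<^sub>M b\<in>insert (axis m 1) (Basis - {axis m 1}). lborel))"
    by (simp only: eq)
  also have "\<dots> = (\<integral>\<^sup>+f. (\<integral>\<^sup>+t. g (\<Sum>b\<in>Basis. (f(axis m 1 := t)) b *\<^sub>R b) \<partial>lborel) \<partial>(\<Pi>\<^sub>M b\<in>Basis - {axis m 1 :: real^'n}. lborel))"
    by (rule product_nn_integral_insert) (auto simp: eq)
  finally show ?thesis .
qed

text \<open>With the other coordinates fixed, the shear only translates coordinate \<open>m\<close>
  by coordinate \<open>n\<close>, so translation invariance preserves the inner integral.\<close>

lemma nn_integral_lborel_shear: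
  fixes g :: "real^'n \<Rightarrow> ennreal" and m n :: 'n
  assumes [measurable]: "g \<in> borel_measurable borel" and "m \<noteq> n"
  shows "(\<integral>\<^sup>+x. g (\<chi> i. if i = m then x $ m + x $ n else x $ i) \<partial>lborel) = (\<integral>\<^sup>+x. g x \<partial>lborel)"
proof -
  let ?S = "\<lambda>x::real^'n. \<chi> i. if i = m then x $ m + x $ n else x $ i"
  let ?v = "\<lambda>f t. (\<Sum>b\<in>Basis. (f(axis m 1 := t)) b *\<^sub>R b) :: real^'n"
  have comp: "?v f t $ i = (f(axis m 1 := t)) (axis i 1)" for f t i
  proof -
    have "?v f t $ i = ?v f t \<bullet> axis i 1" by (simp add: inner_axis)
    also have "\<dots> = (f(axis m 1 := t)) (axis i 1)"
      by (subst inner_sum_left_Basis) (auto)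
    finally show ?thesis .
  qed
  have S: "?S (?v f t) = ?v f (f (axis n 1) + 1 * t)" for f t
    unfolding vec_eq_iff comp using \<open>m \<noteq> n\<close> by (auto simp: comp axis_eq_axis)
  have lin: "linear ?S" 
    by (rule linearI) (auto simp: vec_eq_iff algebra_simps)
  have [measurable]: "?S \<in> borel_measurable borel"
    by (intro borel_measurable_continuous_onI linear_continuous_on linear_conv_bounded_linear[THEN iffD1] lin)
  have "(\<integral>\<^sup>+x. g (?S x) \<partial>lborel) =
     (\<integral>\<^sup>+f. (\<integral>\<^sup>+t. g (?S (?v f t)) \<partial>lborel) \<partial>(\<Pi>\<^sub>M b\<in>Basis - {axis m 1 :: real^'n}. lborel))"
    by (rule nn_integral_lborel_coordinate) measurable
  also have "\<dots> = (\<integral>\<^sup>+f. (\<integral>\<^sup>+t. g (?v f t) \<partial>lborel) \<partial>(\<Pi>\<^sub>M b\<in>Basis - {axis m 1 :: real^'n}. lborel))"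
  proof (rule nn_integral_cong)
    fix f :: "real^'n \<Rightarrow> real"
    have "continuous_on UNIV (\<lambda>t. (f(axis m 1 := t)) b)" for b
      by (cases "b = axis m 1") (simp_all add: continuous_on_id continuous_on_const)
    then have "continuous_on UNIV (?v f)"
      by (intro continuous_on_sum continuous_on_scaleR continuous_on_const)
    then have [measurable]: "(\<lambda>t. ?v f t) \<in> borel_measurable borel"
      by (rule borel_measurable_continuous_onI)
    have "(\<integral>\<^sup>+t. g (?v f t) \<partial>lborel) = (\<integral>\<^sup>+t. g (?v f (f (axis n 1) + 1 * t)) \<partial>lborel)"
      by (subst nn_integral_real_affine[where c = 1 and t = "f (axis n 1)"]) auto
    then show "(\<integral>\<^sup>+t. g (?S (?v f t)) \<partial>lborel) = (\<integral>\<^sup>+t. g (?v f t) \<partial>lborel)"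
      unfolding S by simp
  qed
  also have "\<dots> = (\<integral>\<^sup>+x. g x \<partial>lborel)"
    by (rule nn_integral_lborel_coordinate[symmetric]) measurable
  finally show ?thesis .
qed

text \<open>Boxes determine \<open>lborel\<close>; the preimage of a box is the box with its sides
  permuted, and the product of the side lengths does not depend on their order.\<close>

lemma lborel_distr_permute_coordinates:
  fixes q :: "'n::finite \<Rightarrow> 'n"
  assumes "bij q"
  shows "distr lborel borel (\<lambda>x::real^'n. \<chi> i. x $ q i) = lborel"
proof (rule lborel_eqI[symmetric])
  let ?S = "\<lambda>x::real^'n. \<chi> i. x $ q i"
  have lin: "linear ?S" 
    by (rule linearI) (auto simp: vec_eq_iff algebra_simps)
  have [measurable]: "?S \<in> borel_measurable borel"
    by (intro borel_measurable_continuous_onI linear_continuous_on linear_conv_bounded_linear[THEN iffD1] lin)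
  show "sets (distr lborel borel ?S) = sets borel" by simp
  fix l u :: "real^'n"
  assume le: "\<And>b. b \<in> Basis \<Longrightarrow> l \<bullet> b \<le> u \<bullet> b"
  have le': "l $ i \<le> u $ i" for i
    using le[of "axis i 1"] by (simp add: inner_axis)
  define r where "r = inv q"
  have qr: "q (r i) = i" "r (q i) = i" for i
    using assms by (simp_all add: r_def bij_is_surj surj_f_inv_f bij_is_inj)
  let ?l = "\<chi> i. l $ r i" and ?u = "\<chi> i. u $ r i"
  have bas: "(\<forall>b\<in>Basis. P b) \<longleftrightarrow> (\<forall>i. P (axis i (1::real)))" for P :: "real^'n \<Rightarrow> bool"
    by (auto simp: Basis_vec_def)
  have "?S -` box l u = box ?l ?u"
    apply (auto simp: box_def bas inner_axis) using qr by metis+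
  then have "emeasure (distr lborel borel ?S) (box l u) = emeasure lborel (box ?l ?u)"
    by (subst emeasure_distr) auto
  also have "\<dots> = (\<Prod>b\<in>Basis. (?u - ?l) \<bullet> b)"
    using le' by (subst emeasure_lborel_box) (auto simp: Basis_vec_def inner_axis)
  also have "(\<Prod>b\<in>Basis. (?u - ?l) \<bullet> b) = (\<Prod>i\<in>UNIV. (u - l) $ r i)"
    by (subst prod.reindex[of "\<lambda>i. axis i (1::real)" UNIV, unfolded o_def, symmetric, THEN trans[rotated]])
       (auto simp: Basis_vec_def inj_on_def axis_eq_axis inner_axis intro!: prod.cong)
  also have "(\<Prod>i\<in>UNIV. (u - l) $ r i) = (\<Prod>i\<in>UNIV. (u - l) $ i)"
    by (rule prod.reindex_bij_betw) (simp add: r_def bij_imp_bij_inv assms)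
  also have "\<dots> = (\<Prod>b\<in>Basis. (u - l) \<bullet> b)"
    by (subst prod.reindex[of "\<lambda>i. axis i (1::real)" UNIV, unfolded o_def, symmetric, THEN trans[rotated]])
       (auto simp: Basis_vec_def inj_on_def axis_eq_axis inner_axis intro!: prod.cong)
  finally show "emeasure (distr lborel borel ?S) (box l u) = (\<Prod>b\<in>Basis. (u - l) \<bullet> b)" .
qed

text \<open>The versions in HOL-Analysis require the index type to be well-ordered.\<close>

theorem nn_integral_lborel_linear:
  fixes f :: "real^'n \<Rightarrow> real^'n" and g :: "real^'n \<Rightarrow> ennreal"
  assumes "linear f" "det (matrix f) \<noteq> 0" "g \<in> borel_measurable borel"
  shows "ennreal \<bar>det (matrix f)\<bar> * (\<integral>\<^sup>+x. g (f x) \<partial>lborel) = (\<integral>\<^sup>+x. g x \<partial>lborel)"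
proof -
  \<comment> \<open>The induction over elementary maps also meets singular ones, so nonsingularity
    is a premise inside \<open>?P\<close>. The integrand is quantified there because a composition
    uses the claim for the inner map at \<open>g\<close> composed with the outer one.\<close>
  let ?P = "\<lambda>f::real^'n \<Rightarrow> real^'n. det (matrix f) \<noteq> 0 \<longrightarrow> (\<forall>g\<in>borel_measurable borel.
    ennreal \<bar>det (matrix f)\<bar> * (\<integral>\<^sup>+x. g (f x) \<partial>lborel) = (\<integral>\<^sup>+x. g x \<partial>lborel))"
  have "?P f"
    using \<open>linear f\<close>
  proof (rule induct_linear_elementary)
    fix f h :: "real^'n \<Rightarrow> real^'n"
    assume lin: "linear f" "linear h" and P: "?P f" "?P h"
    have [measurable]: "f \<in> borel_measurable borel"
      by (intro borel_measurable_continuous_onI linear_continuous_on linear_conv_bounded_linear[THEN iffD1] lin)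
    have m: "matrix (f \<circ> h) = matrix f ** matrix h"
      using lin by (simp add: matrix_compose)
    show "?P (f \<circ> h)"
    proof (intro impI ballI)
      fix g :: "real^'n \<Rightarrow> ennreal" assume [measurable]: "g \<in> borel_measurable borel"
      assume "det (matrix (f \<circ> h)) \<noteq> 0"
      then have nz: "det (matrix f) \<noteq> 0" "det (matrix h) \<noteq> 0" by (auto simp: m det_mul)
      have "ennreal \<bar>det (matrix h)\<bar> * (\<integral>\<^sup>+x. g (f (h x)) \<partial>lborel) = (\<integral>\<^sup>+x. g (f x) \<partial>lborel)"
        using P(2) nz(2) by (auto dest!: bspec[where x = "\<lambda>x. g (f x)"])
      moreover have "ennreal \<bar>det (matrix f)\<bar> * (\<integral>\<^sup>+x. g (f x) \<partial>lborel) = (\<integral>\<^sup>+x. g x \<partial>lborel)"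
        using P(1) nz(1) by auto
      ultimately show "ennreal \<bar>det (matrix (f \<circ> h))\<bar> * (\<integral>\<^sup>+x. g ((f \<circ> h) x) \<partial>lborel) = (\<integral>\<^sup>+x. g x \<partial>lborel)"
        by (simp add: m det_mul abs_mult ennreal_mult mult.assoc)
    qed
  next
    fix f :: "real^'n \<Rightarrow> real^'n" and i
    assume lin: "linear f" and z: "\<And>x. f x $ i = 0"
    then have "row i (matrix f) = 0"
      by (simp add: row_def matrix_def vec_eq_iff)
    then show "?P f"
      using det_zero_row(1)[of i "matrix f"] by blast
  next
    fix c :: "'n \<Rightarrow> real"
    let ?S = "\<lambda>x::real^'n. \<chi> i. c i * x $ i"
    have d: "det (matrix ?S) = (\<Prod>i\<in>UNIV. c i)"
      by (subst det_diagonal) (auto simp: matrix_def axis_def)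
    show "?P ?S"
    proof (intro impI ballI)
      fix g :: "real^'n \<Rightarrow> ennreal" assume [measurable]: "g \<in> borel_measurable borel"
      assume "det (matrix ?S) \<noteq> 0"
      then have c: "c i \<noteq> 0" for i unfolding d by auto
      \<comment> \<open>\<open>lborel_affine_euclidean\<close> takes one factor per basis vector, so
        the scaling \<open>c\<close> is transported from indices to \<open>Basis\<close>.\<close>
      define c' where "c' b = c (THE i. b = axis i (1::real))" for b
      have c': "c' (axis i 1) = c i" for i
        by (simp add: c'_def axis_eq_axis)
      have Basis: "(Basis::(real^'n) set) = range (\<lambda>i. axis i 1)"
        by (auto simp: Basis_vec_def)
      have S: "?S x = 0 + (\<Sum>j\<in>Basis. (c' j * (x \<bullet> j)) *\<^sub>R j)" for x
      proof -
        have "(\<Sum>j\<in>Basis. (c' j * (x \<bullet> j)) *\<^sub>R j) = (\<Sum>i\<in>UNIV. (c i * x $ i) *\<^sub>R axis i 1)"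
          unfolding Basis by (subst sum.reindex) (auto simp: inj_on_def axis_eq_axis c' inner_axis)
        also have "\<dots> = ?S x"
          by (auto simp: vec_eq_iff axis_def if_distrib cong: if_cong)
        finally show ?thesis by simp
      qed
      have p: "(\<Prod>j\<in>Basis. \<bar>c' j\<bar>) = \<bar>\<Prod>i\<in>UNIV. c i\<bar>"
        unfolding Basis by (subst prod.reindex) (auto simp: inj_on_def axis_eq_axis c' abs_prod)
      have lin: "linear ?S" 
        by (rule linearI) (auto simp: vec_eq_iff algebra_simps)
      have [measurable]: "?S \<in> borel_measurable borel"
        by (intro borel_measurable_continuous_onI linear_continuous_on linear_conv_bounded_linear[THEN iffD1] lin)
      have "(lborel :: (real^'n) measure) = density (distr lborel borel ?S) (\<lambda>_. ennreal \<bar>\<Prod>i\<in>UNIV. c i\<bar>)"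
        unfolding S p[symmetric] by (rule lborel_affine_euclidean) (auto simp: Basis c' c)
      then have "(\<integral>\<^sup>+x. g x \<partial>lborel) = (\<integral>\<^sup>+x. g x \<partial>density (distr lborel borel ?S) (\<lambda>_. ennreal \<bar>\<Prod>i\<in>UNIV. c i\<bar>))"
        by simp
      also have "\<dots> = ennreal \<bar>det (matrix ?S)\<bar> * (\<integral>\<^sup>+x. g (?S x) \<partial>lborel)"
        unfolding d by (simp add: nn_integral_density nn_integral_distr nn_integral_cmult)
      finally show "ennreal \<bar>det (matrix ?S)\<bar> * (\<integral>\<^sup>+x. g (?S x) \<partial>lborel) = (\<integral>\<^sup>+x. g x \<partial>lborel)" ..
    qed
  next
    fix m n :: 'n
    assume "m \<noteq> n"
    let ?t = "Transposition.transpose m n"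
    let ?S = "\<lambda>x::real^'n. \<chi> i. x $ ?t i"
    have M: "matrix ?S = (\<chi> i. (mat 1 :: real^'n^'n) $ ?t i)"
      by (auto simp: matrix_def mat_def vec_eq_iff axis_def)
    have d: "det (matrix ?S) = of_int (sign ?t)"
      unfolding M by (subst det_permute_rows) (auto simp: permutes_swap_id)
    have lin: "linear ?S" 
      by (rule linearI) (auto simp: vec_eq_iff algebra_simps)
    have [measurable]: "?S \<in> borel_measurable borel"
      by (intro borel_measurable_continuous_onI linear_continuous_on linear_conv_bounded_linear[THEN iffD1] lin)
    show "?P ?S"
    proof (intro impI ballI)
      fix g :: "real^'n \<Rightarrow> ennreal" assume [measurable]: "g \<in> borel_measurable borel"
      have "(\<integral>\<^sup>+x. g x \<partial>lborel) = (\<integral>\<^sup>+x. g x \<partial>distr lborel borel ?S)"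
        by (subst lborel_distr_permute_coordinates) auto
      also have "\<dots> = (\<integral>\<^sup>+x. g (?S x) \<partial>lborel)"
        by (rule nn_integral_distr) measurable
      finally show "ennreal \<bar>det (matrix ?S)\<bar> * (\<integral>\<^sup>+x. g (?S x) \<partial>lborel) = (\<integral>\<^sup>+x. g x \<partial>lborel)"
        unfolding d by (simp add: sign_def)
    qed
  next
    fix m n :: 'n
    assume mn: "m \<noteq> n"
    let ?S = "\<lambda>x::real^'n. \<chi> i. if i = m then x $ m + x $ n else x $ i"
    have M: "matrix ?S = (\<chi> k. if k = m then row m (mat 1) + 1 *s row n (mat 1) else row k (mat 1 :: real^'n^'n))"
      by (auto simp: matrix_def mat_def vec_eq_iff axis_def row_def)
    have "det (matrix ?S) = 1"
      unfolding M using det_row_operation[OF mn, of "mat 1 :: real^'n^'n" 1] by (simp add: det_I)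
    then show "?P ?S"
      using nn_integral_lborel_shear[OF _ mn] by simp
  qed
  then show ?thesis using assms by blast
qed

subsection \<open>Positive definite matrices and Gaussian integrals\<close>

lemma inner_symmetric_matrix:
  fixes A :: "real^'d^'d"
  assumes "transpose A = A"
  shows "x \<bullet> (A *v y) = y \<bullet> (A *v x)"
  by (metis assms dot_lmul_matrix inner_commute transpose_matrix_vector)

lemma pos_def_symmetric: "pos_def A \<Longrightarrow> transpose A = A"
  and pos_def_pos: "pos_def A \<Longrightarrow> v \<noteq> 0 \<Longrightarrow> v \<bullet> (A *v v) > 0"
  and pos_def_nonneg: "pos_def A \<Longrightarrow> v \<bullet> (A *v v) \<ge> 0"
  by (auto simp: pos_def_def) (metis inner_zero_left less_eq_real_def)

lemma pos_def_invertible: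
  fixes A :: "real^'d^'d"
  assumes "pos_def A"
  shows "invertible A"
  unfolding invertible_left_inverse matrix_left_invertible_ker
  using pos_def_pos[OF assms] by force

lemma matrix_inv_vector:
  fixes A :: "real^'d^'d"
  assumes "pos_def A"
  shows "A *v (matrix_inv A *v b) = b" "matrix_inv A *v (A *v b) = b"
proof -
  have "A ** matrix_inv A = mat 1 \<and> matrix_inv A ** A = mat 1"
    unfolding matrix_inv_def using pos_def_invertible[OF assms] unfolding invertible_def by (rule someI_ex)
  then show "A *v (matrix_inv A *v b) = b" "matrix_inv A *v (A *v b) = b"
    by (simp_all add: matrix_vector_mul_assoc)
qed

text \<open>Gram-Schmidt for the inner product \<open>x \<bullet> (A *v y)\<close>: the columns of
  \<open>T\<close> are orthonormal for it, so \<open>transpose T ** (A ** T)\<close> is the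
  identity. In the Gaussian integral \<open>T\<close> plays the part of an inverse square root of
  \<open>A\<close>.\<close>

lemma ex_matrix_orthonormal_wrt:
  fixes A :: "real^'d^'d"
  assumes A: "pos_def A"
  obtains T :: "real^'d^'d" where "\<And>u. (T *v u) \<bullet> (A *v (T *v u)) = u \<bullet> u" "(det T)\<^sup>2 * det A = 1"
proof -
  note sym = inner_symmetric_matrix[OF pos_def_symmetric[OF A]]
  \<comment> \<open>While an \<open>A\<close>-orthonormal set has fewer elements than the dimension,
    the images \<open>A *v v\<close> span a proper subspace, so some nonzero vector is orthogonal to
    all of them; normalised, it extends the set.\<close>
  have "\<exists>B. finite B \<and> card B = k \<and> (\<forall>v\<in>B. v \<bullet> (A *v v) = 1) \<and> (\<forall>v\<in>B. \<forall>w\<in>B. v \<noteq> w \<longrightarrow> v \<bullet> (A *v w) = 0)"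
    if "k \<le> CARD('d)" for k
    using that
  proof (induction k)
    case 0
    show ?case by (rule exI[of _ "{}"]) auto
  next
    case (Suc k)
    then obtain B where B: "finite B" "card B = k" "\<And>v. v \<in> B \<Longrightarrow> v \<bullet> (A *v v) = 1"
      "\<And>v w. v \<in> B \<Longrightarrow> w \<in> B \<Longrightarrow> v \<noteq> w \<Longrightarrow> v \<bullet> (A *v w) = 0"
      by (meson Suc_leD)
    have "dim ((*v) A ` B) \<le> card ((*v) A ` B)"
      by (rule dim_le_card') (use B in auto)
    also have "\<dots> \<le> k" using B card_image_le by blast
    also have "\<dots> < DIM(real^'d)" using Suc by simp
    finally obtain x where x: "x \<noteq> 0" "\<And>y. y \<in> span ((*v) A ` B) \<Longrightarrow> orthogonal x y"
      by (rule orthogonal_to_subspace_exists) blast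
    then have orth: "x \<bullet> (A *v v) = 0" if "v \<in> B" for v
      using that by (auto simp: orthogonal_def span_base)
    define c where "c = sqrt (x \<bullet> (A *v x))"
    have c: "c > 0" "c\<^sup>2 = x \<bullet> (A *v x)" using pos_def_pos[OF A x(1)] by (auto simp: c_def)
    define x' where "x' = (1 / c) *\<^sub>R x"
    have 1: "x' \<bullet> (A *v x') = 1"
      using c(1) by (simp add: x'_def matrix_vector_mult_scaleR c(2)[symmetric] power2_eq_square)
    have 0: "x' \<bullet> (A *v v) = 0" "v \<bullet> (A *v x') = 0" if "v \<in> B" for v
      using orth[OF that] sym[of v x] by (simp_all add: x'_def matrix_vector_mult_scaleR)
    have "x' \<notin> B" using 1 0 by force
    then show ?case
      using B 0 1 by (intro exI[of _ "insert x' B"]) auto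
  qed
  from this[of "CARD('d)"] obtain B where B: "finite B" "card B = CARD('d)"
      "\<And>v. v \<in> B \<Longrightarrow> v \<bullet> (A *v v) = 1"
      "\<And>v w. v \<in> B \<Longrightarrow> w \<in> B \<Longrightarrow> v \<noteq> w \<Longrightarrow> v \<bullet> (A *v w) = 0"
    by blast
  then obtain h where h: "bij_betw h (UNIV :: 'd set) B"
    by (metis finite_class.finite_UNIV finite_same_card_bij)
  define T :: "real^'d^'d" where "T = (\<chi> i j. h j $ i)"
  have hB: "h i \<in> B" for i using h by (auto simp: bij_betw_def)
  have hi: "h i \<noteq> h j" if "i \<noteq> j" for i j using h that by (auto simp: bij_betw_def inj_on_def)
  have "(transpose T ** (A ** T)) $ i $ j = h i \<bullet> (A *v h j)" for i j
    by (simp add: T_def matrix_matrix_mult_def matrix_vector_mult_def transpose_def inner_vec_def)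
  then have TAT: "transpose T ** (A ** T) = mat 1"
    using B hB hi by (auto simp: vec_eq_iff mat_def)
  show ?thesis
  proof
    fix u
    have "(T *v u) \<bullet> (A *v (T *v u)) = u \<bullet> ((transpose T ** (A ** T)) *v u)"
      by (metis dot_lmul_matrix matrix_vector_mul_assoc transpose_matrix_vector inner_commute)
    then show "(T *v u) \<bullet> (A *v (T *v u)) = u \<bullet> u" by (simp add: TAT)
  next
    have "det (transpose T ** (A ** T)) = 1" unfolding TAT by simp
    then show "(det T)\<^sup>2 * det A = 1" by (simp add: det_mul power2_eq_square algebra_simps)
  qed
qed

lemma pos_def_det_pos:
  fixes A :: "real^'d^'d"
  assumes "pos_def A"
  shows "det A > 0"
  using ex_matrix_orthonormal_wrt[OF assms]
  by (metis mult_nonneg_nonpos not_less not_one_le_zero zero_le_power2 leI)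

text \<open>Classically this is (2 pi)^(d/2). It stays symbolic because it cancels from both sides
  of the mixture estimate, which takes only that it is neither 0 nor infinite. The dimension is
  passed as a type.\<close>

definition gauss_const :: "'d::finite itself \<Rightarrow> ennreal" where
  "gauss_const _ = (\<integral>\<^sup>+(x::real^'d). ennreal (exp (- (x \<bullet> x) / 2)) \<partial>lborel)"

text \<open>The integral factors into one-dimensional ones; each of these, times a constant, is the
  total mass 1 of the standard normal law, which excludes 0 and infinity.\<close>

lemma gauss_const_finite_pos:
  "gauss_const TYPE('d::finite) \<noteq> 0" "gauss_const TYPE('d) \<noteq> \<infinity>"
proof -
  let ?g = "\<integral>\<^sup>+(x::real). ennreal (exp (- x\<^sup>2 / 2)) \<partial>lborel"
  have "ennreal (1 / sqrt (2 * pi)) * ?g = (\<integral>\<^sup>+x. ennreal (std_normal_density x) \<partial>lborel)"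
    by (subst nn_integral_cmult[symmetric]) (auto simp: std_normal_density_def ennreal_mult[symmetric] intro!: nn_integral_cong)
  also have "\<dots> = 1"
    using prob_space.emeasure_space_1[OF prob_space_normal_density[of 1 0]]
    by (simp add: emeasure_density)
  finally have g: "ennreal (1 / sqrt (2 * pi)) * ?g = 1" .
  then have "?g \<noteq> 0" by auto
  moreover have "?g \<noteq> \<infinity>" using g by (auto simp: ennreal_mult_top)
  moreover have "gauss_const TYPE('d) = (\<Prod>b\<in>(Basis::(real^'d) set). ?g)"
  proof -
    have "gauss_const TYPE('d) = (\<integral>\<^sup>+(x::real^'d). (\<Prod>b\<in>Basis. ennreal (exp (- (x \<bullet> b)\<^sup>2 / 2))) \<partial>lborel)"
      unfolding gauss_const_def
    proof (rule nn_integral_cong)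
      fix x :: "real^'d"
      have "exp (- (x \<bullet> x) / 2) = exp (\<Sum>b\<in>Basis. - (x \<bullet> b)\<^sup>2 / 2)"
        by (subst euclidean_inner) (simp only: power2_eq_square sum_negf sum_divide_distrib[symmetric])
      then show "ennreal (exp (- (x \<bullet> x) / 2)) = (\<Prod>b\<in>Basis. ennreal (exp (- (x \<bullet> b)\<^sup>2 / 2)))"
        by (simp add: exp_sum prod_ennreal)
    qed
    also have "\<dots> = (\<Prod>b\<in>(Basis::(real^'d) set). ?g)"
      by (rule nn_integral_lborel_prod) auto
    finally show ?thesis .
  qed
  ultimately show "gauss_const TYPE('d) \<noteq> 0" "gauss_const TYPE('d) \<noteq> \<infinity>"
    by (simp_all add: power_eq_top_ennreal)
qed

text \<open>Completing the square at the centre \<open>c\<close> and substituting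
  \<open>c + T *v u\<close>, with \<open>T\<close> from \<open>ex_matrix_orthonormal_wrt\<close>,
  leaves the standard Gaussian with Jacobian \<open>1 / sqrt (det A)\<close>.\<close>

theorem nn_integral_gaussian:
  fixes A :: "real^'d^'d"
  assumes A: "pos_def A"
  shows "(\<integral>\<^sup>+x. ennreal (exp (b \<bullet> x - x \<bullet> (A *v x) / 2)) \<partial>lborel) =
    gauss_const TYPE('d) * ennreal (exp (b \<bullet> (matrix_inv A *v b) / 2) / sqrt (det A))"
proof -
  obtain T :: "real^'d^'d" where T: "\<And>u. (T *v u) \<bullet> (A *v (T *v u)) = u \<bullet> u" "(det T)\<^sup>2 * det A = 1"
    using ex_matrix_orthonormal_wrt[OF A] by blast
  define c where "c = matrix_inv A *v b"
  have c: "A *v c = b" by (simp add: c_def matrix_inv_vector[OF A])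
  note sym = inner_symmetric_matrix[OF pos_def_symmetric[OF A]]
  let ?g = "\<lambda>x. ennreal (exp (b \<bullet> x - x \<bullet> (A *v x) / 2))"
  have [measurable]: "?g \<in> borel_measurable borel"
    by (intro measurable_compose[OF _ measurable_ennreal] borel_measurable_continuous_onI)
       (intro continuous_intros matrix_vector_mult_linear_continuous_on, simp)
  have det: "\<bar>det T\<bar> = 1 / sqrt (det A)"
  proof -
    have "(det T)\<^sup>2 = 1 / det A"
      using T(2) pos_def_det_pos[OF A] by (simp add: field_simps)
    then have "sqrt ((det T)\<^sup>2) = sqrt (1 / det A)" by simp
    then show ?thesis by (simp add: real_sqrt_divide)
  qed
  have eq: "?g (c + T *v u) = ennreal (exp (b \<bullet> c / 2)) * ennreal (exp (- (u \<bullet> u) / 2))" for u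
  proof -
    have "b \<bullet> (T *v u) = (T *v u) \<bullet> (A *v c)" by (simp add: c inner_commute)
    then have "b \<bullet> (c + T *v u) - (c + T *v u) \<bullet> (A *v (c + T *v u)) / 2 = b \<bullet> c / 2 + - (u \<bullet> u) / 2"
      using sym[of c "T *v u"] T(1)[of u]
      by (simp add: inner_add_left inner_add_right matrix_vector_right_distrib c inner_commute field_simps)
    then show ?thesis by (simp only: exp_add ennreal_mult[OF exp_ge_zero exp_ge_zero])
  qed
  have "(\<integral>\<^sup>+x. ?g x \<partial>lborel) = (\<integral>\<^sup>+x. ?g x \<partial>distr lborel borel ((+) c))"
    by (simp add: lborel_distr_plus)
  also have "\<dots> = (\<integral>\<^sup>+x. ?g (c + x) \<partial>lborel)"
    by (rule nn_integral_distr) measurable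
  also have "\<dots> = ennreal \<bar>det (matrix ((*v) T))\<bar> * (\<integral>\<^sup>+u. ?g (c + T *v u) \<partial>lborel)"
  proof (rule nn_integral_lborel_linear[symmetric])
    show "(\<lambda>x. ?g (c + x)) \<in> borel_measurable borel" by measurable
  qed (use T(2) in auto)
  also have "(\<integral>\<^sup>+u. ?g (c + T *v u) \<partial>lborel) = (\<integral>\<^sup>+(u::real^'d). ennreal (exp (b \<bullet> c / 2)) * ennreal (exp (- (u \<bullet> u) / 2)) \<partial>lborel)"
    unfolding eq ..
  also have "\<dots> = ennreal (exp (b \<bullet> c / 2)) * gauss_const TYPE('d)"
    unfolding gauss_const_def by (rule nn_integral_cmult) measurable
  finally have "(\<integral>\<^sup>+x. ?g x \<partial>lborel) = gauss_const TYPE('d) * (ennreal (exp (b \<bullet> c / 2)) * ennreal (1 / sqrt (det A)))"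
    by (simp only: matrix_of_matrix_vector_mul det mult_ac)
  also have "ennreal (exp (b \<bullet> c / 2)) * ennreal (1 / sqrt (det A)) = ennreal (exp (b \<bullet> c / 2) / sqrt (det A))"
    by (subst ennreal_mult[symmetric]) (use pos_def_det_pos[OF A] in auto)
  finally show ?thesis by (simp only: c_def)
qed

subsection \<open>Extremal eigenvalues of symmetric matrices\<close>

text \<open>A minimiser \<open>v\<close> of the quadratic form over the unit sphere is an
  eigenvector by a first-order variation; homogeneity extends the bound from the sphere to all
  vectors.\<close>

lemma rayleigh_min_eigenvector:
  fixes A :: "real^'d^'d"
  assumes sym: "transpose A = A"
  obtains v l where "v \<noteq> 0" "A *v v = l *\<^sub>R v" "\<And>x. l * (x \<bullet> x) \<le> x \<bullet> (A *v x)"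
proof -
  let ?q = "\<lambda>x. x \<bullet> (A *v x)"
  have "compact (sphere (0::real^'d) 1)" "sphere (0::real^'d) 1 \<noteq> {}"
    by simp_all
  moreover have "continuous_on (sphere 0 1) ?q"
    by (intro continuous_intros matrix_vector_mult_linear_continuous_on)
  ultimately obtain v where v: "v \<in> sphere 0 1" "\<And>x. x \<in> sphere 0 1 \<Longrightarrow> ?q v \<le> ?q x"
    using continuous_attains_inf[of "sphere 0 1" ?q] by blast
  define l where "l = ?q v"
  have nv: "norm v = 1" "v \<bullet> v = 1" using v(1) by (auto simp: dot_square_norm)
  have min: "l * (x \<bullet> x) \<le> ?q x" for x
  proof (cases "x = 0")
    case False
    have "l \<le> ?q ((1 / norm x) *\<^sub>R x)"
      unfolding l_def by (rule v(2)) (use False in simp)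
    also have "\<dots> = ?q x / (norm x)\<^sup>2"
      by (simp add: matrix_vector_mult_scaleR power2_eq_square)
    finally show ?thesis using False by (simp add: field_simps dot_square_norm)
  qed simp
  have "A *v v = l *\<^sub>R v"
  proof (rule ccontr)
    assume ne: "A *v v \<noteq> l *\<^sub>R v"
    \<comment> \<open>Were the residual \<open>u\<close> nonzero, moving from \<open>v\<close>
      slightly along \<open>- u\<close> would make \<open>?q x - l * (x \<bullet> x)\<close>
      negative, although it is nonnegative everywhere and vanishes at \<open>v\<close>.\<close>
    define u where "u = A *v v - l *\<^sub>R v"
    have u: "u \<bullet> u > 0" using ne by (simp add: u_def)
    define K where "K = ?q u - l * (u \<bullet> u)"
    have "K \<ge> 0" using min[of u] by (simp add: K_def)
    have ineq: "0 \<le> 2 * t * (u \<bullet> u) + t\<^sup>2 * K" for t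
    proof -
      have "?q (v + t *\<^sub>R u) - l * ((v + t *\<^sub>R u) \<bullet> (v + t *\<^sub>R u)) = 2 * t * (u \<bullet> u) + t\<^sup>2 * K"
      proof -
        have "u \<bullet> (A *v v) = u \<bullet> u + l * (u \<bullet> v)"
          by (simp add: u_def inner_diff_right inner_diff_left algebra_simps)
        then show ?thesis
          using inner_symmetric_matrix[OF sym, of v u]
          by (simp add: matrix_vector_right_distrib matrix_vector_mult_scaleR inner_add_left inner_add_right
              K_def l_def nv power2_eq_square inner_commute[of v u] algebra_simps)
      qed
      then show ?thesis using min[of "v + t *\<^sub>R u"] by simp
    qed
    have "K + 1 > 0" using \<open>K \<ge> 0\<close> by simp
    \<comment> \<open>\<open>K\<close> may be 0, hence the denominator \<open>K + 1\<close>; with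
      this \<open>t\<close> the variation equals
      \<open>t * (u \<bullet> u) - t\<^sup>2\<close>.\<close>
    define t where "t = - (u \<bullet> u) / (K + 1)"
    have t: "t * (K + 1) = - (u \<bullet> u)" "t < 0"
      using u \<open>K + 1 > 0\<close> by (simp_all add: t_def)
    have "2 * t * (u \<bullet> u) + t\<^sup>2 * K = 2 * t * (u \<bullet> u) + t * (t * (K + 1)) - t\<^sup>2"
      by (simp add: power2_eq_square algebra_simps)
    also have "\<dots> = t * (u \<bullet> u) - t\<^sup>2" by (simp add: t(1))
    also have "\<dots> < 0"
      using mult_neg_pos[OF t(2) u] zero_le_power2[of t] by linarith
    finally show False using ineq[of t] by simp
  qed
  have "v \<noteq> 0" using nv by auto
  then show ?thesis using \<open>A *v v = l *\<^sub>R v\<close> min by (rule that)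
qed

text \<open>Eigenvectors for distinct eigenvalues of a symmetric matrix are orthogonal, hence
  independent. Finiteness is what gives \<open>Min\<close> and \<open>Max\<close> over the spectrum
  their meaning.\<close>

lemma finite_eigenvals:
  fixes A :: "real^'d^'d"
  assumes sym: "transpose A = A"
  shows "finite (eigenvals A)"
proof -
  have "\<forall>l\<in>eigenvals A. \<exists>v. v \<noteq> 0 \<and> A *v v = l *\<^sub>R v"
    by (auto simp: eigenvals_def)
  then obtain e where e: "\<And>l. l \<in> eigenvals A \<Longrightarrow> e l \<noteq> 0" "\<And>l. l \<in> eigenvals A \<Longrightarrow> A *v e l = l *\<^sub>R e l"
    by metis
  have orth: "e l \<bullet> e k = 0" if "l \<in> eigenvals A" "k \<in> eigenvals A" "l \<noteq> k" for l k
    using inner_symmetric_matrix[OF sym, of "e l" "e k"] e(2)[OF that(1)] e(2)[OF that(2)] that(3)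
    by (simp add: inner_commute)
  have "independent (e ` eigenvals A)"
  proof (rule pairwise_orthogonal_independent)
    show "pairwise orthogonal (e ` eigenvals A)"
      using orth by (auto simp: pairwise_def orthogonal_def)
    show "0 \<notin> e ` eigenvals A" using e(1) by force
  qed
  then have "finite (e ` eigenvals A)"
    by (rule independent_imp_finite)
  moreover have "inj_on e (eigenvals A)"
    using orth e(1) by (intro inj_onI) (metis inner_eq_zero_iff)
  ultimately show ?thesis using finite_imageD by blast
qed

text \<open>The variational form of the smallest eigenvalue. The equivalence serves both as a lower
  bound on the quadratic form and as a description of superlevel sets for measurability.\<close>

lemma min_eig_greatest:
  fixes A :: "real^'d^'d"
  assumes sym: "transpose A = A"
  shows "a \<le> min_eig A \<longleftrightarrow> (\<forall>x. a * (x \<bullet> x) \<le> x \<bullet> (A *v x))"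
proof -
  obtain v l where v: "v \<noteq> 0" "A *v v = l *\<^sub>R v" "\<And>x. l * (x \<bullet> x) \<le> x \<bullet> (A *v x)"
    by (rule rayleigh_min_eigenvector[OF sym]) (rule that)
  have "min_eig A = l"
    unfolding min_eig_def
  proof (rule Min_eqI)
    show "finite (eigenvals A)" by (rule finite_eigenvals[OF sym])
    show "l \<in> eigenvals A" using v by (auto simp: eigenvals_def)
    fix k assume "k \<in> eigenvals A"
    then obtain w where w: "w \<noteq> 0" "A *v w = k *\<^sub>R w" by (auto simp: eigenvals_def)
    with v(3)[of w] show "l \<le> k" by simp
  qed
  moreover have "a \<le> l" if "\<forall>x. a * (x \<bullet> x) \<le> x \<bullet> (A *v x)"
    using that[rule_format, of v] v by simp
  moreover have "a * (x \<bullet> x) \<le> x \<bullet> (A *v x)" if "a \<le> l" for x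
    using v(3)[of x] mult_right_mono[OF that, of "x \<bullet> x"] by simp
  ultimately show ?thesis by auto
qed

lemma uminus_matrix_vector_mult:
  fixes A :: "real^'n^'m"
  shows "(- A) *v x = - (A *v x)"
  by (simp add: matrix_vector_mult_def vec_eq_iff sum_negf)

lemma max_eig_eq_min_eig_uminus:
  fixes A :: "real^'d^'d"
  assumes sym: "transpose A = A"
  shows "max_eig A = - min_eig (- A)"
proof -
  have "- (A *v v) = l *\<^sub>R v \<longleftrightarrow> A *v v = (- l) *\<^sub>R v" for l v
    by (metis minus_equation_iff scaleR_minus_left)
  then have "l \<in> eigenvals (- A) \<longleftrightarrow> - l \<in> eigenvals A" for l
    by (simp add: eigenvals_def uminus_matrix_vector_mult)
  then have E: "eigenvals (- A) = uminus ` eigenvals A"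
    by (force simp: image_iff equation_minus_iff)
  have "eigenvals A \<noteq> {}"
    by (rule rayleigh_min_eigenvector[OF sym]) (auto simp: eigenvals_def)
  then have "- Max (eigenvals A) = Min (eigenvals (- A))"
    unfolding E by (rule minus_Max_eq_Min[OF finite_eigenvals[OF sym]])
  then show ?thesis
    unfolding max_eig_def min_eig_def by linarith
qed

lemma max_eig_upper:
  fixes A :: "real^'d^'d"
  assumes sym: "transpose A = A"
  shows "x \<bullet> (A *v x) \<le> max_eig A * (x \<bullet> x)"
proof -
  have "transpose (- A) = - A" using sym by (simp add: transpose_def vec_eq_iff)
  then have "min_eig (- A) * (x \<bullet> x) \<le> x \<bullet> ((- A) *v x)"
    using min_eig_greatest by blast
  then show ?thesis
    by (simp add: max_eig_eq_min_eig_uminus[OF sym] uminus_matrix_vector_mult)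
qed

subsection \<open>Exponential moments of conditionally subgaussian noise\<close>

text \<open>Each past input and noise term is a projection composed with the map that generates the
  sigma-algebra.\<close>

lemma measurable_history:
  assumes [measurable]: "\<xi> \<in> measurable M p" "\<And>j. z j \<in> borel_measurable M" "\<And>j. \<epsilon> j \<in> borel_measurable M"
  shows subalgebra_history: "subalgebra M (history M p \<xi> z \<epsilon> i)"
    and history_input: "j \<le> i \<Longrightarrow> z j \<in> borel_measurable (history M p \<xi> z \<epsilon> i)"
    and history_noise: "j < i \<Longrightarrow> \<epsilon> j \<in> borel_measurable (history M p \<xi> z \<epsilon> i)"
proof -
  let ?f = "\<lambda>\<omega>. (\<xi> \<omega>, \<lambda>j\<in>{..i}. z j \<omega>, \<lambda>j\<in>{..<i}. \<epsilon> j \<omega>)"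
  let ?N = "p \<Otimes>\<^sub>M ((\<Pi>\<^sub>M j\<in>{..i}. borel) \<Otimes>\<^sub>M (\<Pi>\<^sub>M j\<in>{..<i}. borel)) :: ('b \<times> ('c \<Rightarrow> real^2) \<times> ('c \<Rightarrow> real)) measure"
  have f: "?f \<in> measurable M ?N"
    by measurable
  show "subalgebra M (history M p \<xi> z \<epsilon> i)"
    unfolding subalgebra_def history_def using sets_image_in_sets[OF refl f] by simp
  have F: "?f \<in> measurable (history M p \<xi> z \<epsilon> i) ?N"
    unfolding history_def using measurable_space[OF f] by (intro measurable_vimage_algebra1) auto
  have "(\<lambda>\<omega>. (fst (snd (?f \<omega>))) j) \<in> borel_measurable (history M p \<xi> z \<epsilon> i)" if "j \<le> i"
    using that by (intro measurable_compose[OF F]) simp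
  then show "j \<le> i \<Longrightarrow> z j \<in> borel_measurable (history M p \<xi> z \<epsilon> i)" by simp
  have "(\<lambda>\<omega>. (snd (snd (?f \<omega>))) j) \<in> borel_measurable (history M p \<xi> z \<epsilon> i)" if "j < i"
    using that by (intro measurable_compose[OF F]) simp
  then show "j < i \<Longrightarrow> \<epsilon> j \<in> borel_measurable (history M p \<xi> z \<epsilon> i)" by simp
qed

text \<open>The noise hypothesis speaks of \<open>real_cond_exp\<close>, whereas the extended
  integrals below use \<open>nn_cond_exp\<close>. They agree because the negative part vanishes and
  integrability makes the positive part finite almost everywhere.\<close>

lemma (in sigma_finite_subalgebra) nn_cond_exp_eq_real_cond_exp:
  assumes f: "integrable M f" and nonneg: "\<And>x. f x \<ge> 0"
  shows "AE x in M. nn_cond_exp M F (\<lambda>x. ennreal (f x)) x = ennreal (real_cond_exp M F f x)"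
proof -
  have [measurable]: "f \<in> borel_measurable M" using f by simp
  have "(\<integral>\<^sup>+x. nn_cond_exp M F (\<lambda>x. ennreal (f x)) x \<partial>M) = (\<integral>\<^sup>+x. ennreal (f x) \<partial>M)"
    using nn_cond_exp_intg[of "\<lambda>_. 1" "\<lambda>x. ennreal (f x)"] by simp
  also have "\<dots> \<noteq> \<infinity>" using f nonneg by (simp add: nn_integral_eq_integral)
  finally have "AE x in M. nn_cond_exp M F (\<lambda>x. ennreal (f x)) x \<noteq> \<infinity>"
    by (intro nn_integral_PInf_AE) auto
  moreover have "AE x in M. 0 = nn_cond_exp M F (\<lambda>x. ennreal (- f x)) x"
    using nn_cond_exp_F_meas[of "\<lambda>_. 0"] nonneg by (simp add: ennreal_neg)
  ultimately show ?thesis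
    by eventually_elim (auto simp: real_cond_exp_def less_top ennreal_enn2real)
qed

text \<open>The weight \<open>Y\<close> is measurable in \<open>F\<close>, so the exponential may be
  replaced by its conditional expectation, which the compensating factor brings to at most 1.
  Boundedness of the noise supplies integrability of the exponential.\<close>

lemma nn_integral_subgaussian_const:
  fixes e :: "'a \<Rightarrow> real" and Y :: "'a \<Rightarrow> ennreal"
  assumes "prob_space M" and sub: "subalgebra M F"
    and [measurable]: "e \<in> borel_measurable M" and bd: "AE \<omega> in M. \<bar>e \<omega>\<bar> \<le> B"
    and sg: "AE \<omega> in M. real_cond_exp M F (\<lambda>\<omega>. exp (s * e \<omega>)) \<omega> \<le> exp (s\<^sup>2 * \<sigma>\<^sup>2 / 2)"
    and [measurable]: "Y \<in> borel_measurable F"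
  shows "(\<integral>\<^sup>+\<omega>. Y \<omega> * ennreal (exp (s * e \<omega> - s\<^sup>2 * \<sigma>\<^sup>2 / 2)) \<partial>M) \<le> (\<integral>\<^sup>+\<omega>. Y \<omega> \<partial>M)"
proof -
  interpret prob_space M by fact
  interpret finite_measure_subalgebra M F by standard (rule sub)
  have [measurable]: "Y \<in> borel_measurable M" by (rule measurable_from_subalg[OF sub]) measurable
  let ?f = "\<lambda>\<omega>. exp (s * e \<omega>)"
  have "integrable M ?f"
  proof (rule integrable_const_bound[where B = "exp (\<bar>s\<bar> * B)"])
    show "AE \<omega> in M. norm (?f \<omega>) \<le> exp (\<bar>s\<bar> * B)"
      using bd
    proof eventually_elim
      case (elim \<omega>)
      have "s * e \<omega> \<le> \<bar>s\<bar> * \<bar>e \<omega>\<bar>" by (metis abs_ge_self abs_mult)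
      also have "\<dots> \<le> \<bar>s\<bar> * B" using elim by (intro mult_left_mono) auto
      finally show ?case by simp
    qed
  qed measurable
  note eq = nn_cond_exp_eq_real_cond_exp[OF this exp_ge_zero]
  let ?c = "ennreal (exp (- (s\<^sup>2 * \<sigma>\<^sup>2 / 2)))"
  have "(\<integral>\<^sup>+\<omega>. Y \<omega> * ennreal (exp (s * e \<omega> - s\<^sup>2 * \<sigma>\<^sup>2 / 2)) \<partial>M) = (\<integral>\<^sup>+\<omega>. (?c * Y \<omega>) * ennreal (?f \<omega>) \<partial>M)"
    by (intro nn_integral_cong) (simp add: diff_conv_add_uminus exp_add ennreal_mult mult_ac del: add_uminus_conv_diff)
  also have "\<dots> = (\<integral>\<^sup>+\<omega>. (?c * Y \<omega>) * nn_cond_exp M F (\<lambda>\<omega>. ennreal (?f \<omega>)) \<omega> \<partial>M)"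
    by (rule nn_cond_exp_intg[symmetric]) measurable
  also have "\<dots> \<le> (\<integral>\<^sup>+\<omega>. Y \<omega> \<partial>M)"
  proof (rule nn_integral_mono_AE)
    show "AE \<omega> in M. (?c * Y \<omega>) * nn_cond_exp M F (\<lambda>\<omega>. ennreal (?f \<omega>)) \<omega> \<le> Y \<omega>"
      using eq sg
    proof eventually_elim
      case (elim \<omega>)
      have "(?c * Y \<omega>) * nn_cond_exp M F (\<lambda>\<omega>. ennreal (?f \<omega>)) \<omega> \<le> (?c * Y \<omega>) * ennreal (exp (s\<^sup>2 * \<sigma>\<^sup>2 / 2))"
        unfolding elim(1) using elim(2) by (intro mult_left_mono ennreal_leI) auto
      also have "\<dots> = Y \<omega> * (ennreal (exp (- (s\<^sup>2 * \<sigma>\<^sup>2 / 2))) * ennreal (exp (s\<^sup>2 * \<sigma>\<^sup>2 / 2)))"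
        by (simp add: mult_ac)
      also have "\<dots> = Y \<omega>"
        by (subst ennreal_mult[symmetric]) (auto simp: exp_minus)
      finally show ?case .
    qed
  qed
  finally show ?thesis .
qed

text \<open>The hypothesis bounds the conditional moment generating function almost surely for each
  fixed argument, with an exceptional set depending on the argument. A random argument that is
  measurable with respect to the past is therefore approximated by countably valued ones, and
  Fatou's lemma passes to the limit.\<close>

lemma nn_integral_subgaussian_predictable:
  fixes e S Y :: "'a \<Rightarrow> real"
  assumes M: "prob_space M" and sub: "subalgebra M F"
    and e[measurable]: "e \<in> borel_measurable M" and bd: "AE \<omega> in M. \<bar>e \<omega>\<bar> \<le> B"
    and sg: "\<And>s. AE \<omega> in M. real_cond_exp M F (\<lambda>\<omega>. exp (s * e \<omega>)) \<omega> \<le> exp (s\<^sup>2 * \<sigma>\<^sup>2 / 2)"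
    and [measurable]: "Y \<in> borel_measurable F" "S \<in> borel_measurable F"
    and Y: "\<And>\<omega>. Y \<omega> \<ge> 0"
  shows "(\<integral>\<^sup>+\<omega>. ennreal (Y \<omega> * exp (S \<omega> * e \<omega> - (S \<omega>)\<^sup>2 * \<sigma>\<^sup>2 / 2)) \<partial>M) \<le> (\<integral>\<^sup>+\<omega>. ennreal (Y \<omega>) \<partial>M)"
proof -
  have [measurable]: "Y \<in> borel_measurable M" "S \<in> borel_measurable M" 
    by (rule measurable_from_subalg[OF sub], measurable)+
  let ?h = "\<lambda>s \<omega>. exp (s * e \<omega> - s\<^sup>2 * \<sigma>\<^sup>2 / 2)"
  \<comment> \<open>Rounding down to multiples of \<open>1 / real (Suc k)\<close>;
    \<open>Suc\<close> keeps the denominator positive at \<open>k = 0\<close>.\<close>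
  define J where "J k \<omega> = \<lfloor>real (Suc k) * S \<omega>\<rfloor>" for k \<omega>
  define S' where "S' k \<omega> = real_of_int (J k \<omega>) / real (Suc k)" for k \<omega>
  have [measurable]: "J k \<in> measurable F (count_space UNIV)" for k
    unfolding J_def by measurable
  then have [measurable]: "J k \<in> measurable M (count_space UNIV)" for k
    using measurable_from_subalg[OF sub] by blast
  have [measurable]: "(\<lambda>\<omega>. indicator {j} (J k \<omega>) :: ennreal) \<in> borel_measurable F" for j k
    by (rule measurable_compose[where N = "count_space UNIV"]) auto
  then have [measurable]: "(\<lambda>\<omega>. indicator {j} (J k \<omega>) :: ennreal) \<in> borel_measurable M" for j k
    using measurable_from_subalg[OF sub] by blast
  have [measurable]: "S' k \<in> borel_measurable M" for k
    unfolding S'_def by measurable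
  have le: "(\<integral>\<^sup>+\<omega>. ennreal (Y \<omega> * ?h (S' k \<omega>) \<omega>) \<partial>M) \<le> (\<integral>\<^sup>+\<omega>. ennreal (Y \<omega>) \<partial>M)" for k
  proof -
    let ?I = "\<lambda>j \<omega>. ennreal (Y \<omega>) * indicator {j} (J k \<omega>)"
    let ?q = "\<lambda>j. real_of_int j / real (Suc k)"
    \<comment> \<open>For fixed \<open>\<omega>\<close> only the index
      \<open>j = J k \<omega>\<close> survives in the counting integral; Tonelli then isolates each
      constant argument.\<close>
    have split: "(\<integral>\<^sup>+\<omega>. ennreal (Y \<omega>) * g (J k \<omega>) \<omega> \<partial>M) = (\<integral>\<^sup>+j. (\<integral>\<^sup>+\<omega>. ?I j \<omega> * g j \<omega> \<partial>M) \<partial>count_space UNIV)"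
      if [measurable]: "\<And>j. g j \<in> borel_measurable M" for g :: "int \<Rightarrow> 'a \<Rightarrow> ennreal"
    proof -
      have "(\<integral>\<^sup>+j. ?I j \<omega> * g j \<omega> \<partial>count_space UNIV) = (\<Sum>j\<in>{J k \<omega>}. ?I j \<omega> * g j \<omega>)" for \<omega>
        by (rule nn_integral_count_space') auto
      then have "(\<integral>\<^sup>+\<omega>. ennreal (Y \<omega>) * g (J k \<omega>) \<omega> \<partial>M) = (\<integral>\<^sup>+\<omega>. (\<integral>\<^sup>+j. ?I j \<omega> * g j \<omega> \<partial>count_space UNIV) \<partial>M)"
        by simp
      also have "\<dots> = (\<integral>\<^sup>+j. (\<integral>\<^sup>+\<omega>. ?I j \<omega> * g j \<omega> \<partial>M) \<partial>count_space UNIV)"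
        by (rule nn_integral_count_space_nn_integral) auto
      finally show ?thesis .
    qed
    have "(\<integral>\<^sup>+\<omega>. ennreal (Y \<omega> * ?h (S' k \<omega>) \<omega>) \<partial>M) = (\<integral>\<^sup>+\<omega>. ennreal (Y \<omega>) * ennreal (?h (?q (J k \<omega>)) \<omega>) \<partial>M)"
      by (simp add: S'_def ennreal_mult Y)
    also have "\<dots> = (\<integral>\<^sup>+j. (\<integral>\<^sup>+\<omega>. ?I j \<omega> * ennreal (?h (?q j) \<omega>) \<partial>M) \<partial>count_space UNIV)"
      by (rule split) measurable
    also have "\<dots> \<le> (\<integral>\<^sup>+j. (\<integral>\<^sup>+\<omega>. ?I j \<omega> \<partial>M) \<partial>count_space UNIV)"
      by (intro nn_integral_mono nn_integral_subgaussian_const[OF M sub e bd sg]) measurable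
    also have "\<dots> = (\<integral>\<^sup>+\<omega>. ennreal (Y \<omega>) \<partial>M)"
      using split[of "\<lambda>_ _. 1"] by simp
    finally show ?thesis .
  qed
  have lim: "(\<lambda>k. S' k \<omega>) \<longlonglongrightarrow> S \<omega>" for \<omega>
  proof -
    have up: "S' k \<omega> \<le> S \<omega>" for k
    proof -
      have "real_of_int (J k \<omega>) \<le> real (Suc k) * S \<omega>" unfolding J_def by (rule of_int_floor_le)
      then show ?thesis by (simp add: S'_def divide_le_eq mult.commute)
    qed
    have lo: "S \<omega> - 1 / real (Suc k) \<le> S' k \<omega>" for k
    proof -
      have "real (Suc k) * S \<omega> - 1 \<le> real_of_int (J k \<omega>)" unfolding J_def by linarith
      then have "(real (Suc k) * S \<omega> - 1) / real (Suc k) \<le> S' k \<omega>"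
        unfolding S'_def by (intro divide_right_mono) auto
      then show ?thesis by (simp add: diff_divide_distrib)
    qed
    have "(\<lambda>k. S \<omega> - 1 / real (Suc k)) \<longlonglongrightarrow> S \<omega> - 0"
      by (rule tendsto_diff[OF tendsto_const LIMSEQ_Suc[OF lim_1_over_n]])
    then have *: "(\<lambda>k. S \<omega> - 1 / real (Suc k)) \<longlonglongrightarrow> S \<omega>" by (simp only: diff_zero)
    show ?thesis
    proof (rule real_tendsto_sandwich[OF _ _ * tendsto_const])
      show "\<forall>\<^sub>F k in sequentially. S \<omega> - 1 / real (Suc k) \<le> S' k \<omega>" using lo by (intro always_eventually allI)
      show "\<forall>\<^sub>F k in sequentially. S' k \<omega> \<le> S \<omega>" using up by (intro always_eventually allI)
    qed
  qed
  have "(\<integral>\<^sup>+\<omega>. ennreal (Y \<omega> * ?h (S \<omega>) \<omega>) \<partial>M) = (\<integral>\<^sup>+\<omega>. liminf (\<lambda>k. ennreal (Y \<omega> * ?h (S' k \<omega>) \<omega>)) \<partial>M)"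
  proof (rule nn_integral_cong)
    fix \<omega>
    have "(\<lambda>k. ennreal (Y \<omega> * ?h (S' k \<omega>) \<omega>)) \<longlonglongrightarrow> ennreal (Y \<omega> * ?h (S \<omega>) \<omega>)"
      by (rule tendsto_ennrealI, rule tendsto_mult[OF tendsto_const], rule tendsto_exp,
          rule tendsto_diff[OF tendsto_mult[OF lim tendsto_const]],
          rule tendsto_divide[OF tendsto_mult[OF tendsto_power[OF lim] tendsto_const] tendsto_const], simp)
    then show "ennreal (Y \<omega> * ?h (S \<omega>) \<omega>) = liminf (\<lambda>k. ennreal (Y \<omega> * ?h (S' k \<omega>) \<omega>))"
      by (intro lim_imp_Liminf[symmetric]) auto
  qed
  also have "\<dots> \<le> liminf (\<lambda>k. (\<integral>\<^sup>+\<omega>. ennreal (Y \<omega> * ?h (S' k \<omega>) \<omega>) \<partial>M))"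
    by (rule nn_integral_liminf) measurable
  also have "\<dots> \<le> liminf (\<lambda>k. (\<integral>\<^sup>+\<omega>. ennreal (Y \<omega>) \<partial>M))"
    by (intro Liminf_mono always_eventually allI le)
  also have "\<dots> = (\<integral>\<^sup>+\<omega>. ennreal (Y \<omega>) \<partial>M)"
    by (rule Liminf_const) simp
  finally show ?thesis .
qed

text \<open>The largest index \<open>b\<close> is peeled off first: the other factors and the
  argument \<open>g (z b \<omega>)\<close> are measurable in the history of \<open>b\<close>, so the
  predictable bound removes the factor of \<open>b\<close>.\<close>

lemma nn_integral_prod_subgaussian:
  fixes z :: "'n::{finite,linorder} \<Rightarrow> 'a \<Rightarrow> real^2" and g :: "real^2 \<Rightarrow> real"
  assumes M: "prob_space M" and meas: "\<xi> \<in> measurable M p" "\<And>i. z i \<in> borel_measurable M" "\<And>i. \<epsilon> i \<in> borel_measurable M"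
    and noise: "bounded_subgaussian_noise M p \<xi> z \<epsilon> \<sigma>"
    and [measurable]: "g \<in> borel_measurable borel"
  shows "(\<integral>\<^sup>+\<omega>. ennreal (\<Prod>i\<in>A. exp (g (z i \<omega>) * \<epsilon> i \<omega> - (g (z i \<omega>))\<^sup>2 * \<sigma>\<^sup>2 / 2)) \<partial>M) \<le> 1"
proof (induction A rule: finite_linorder_max_induct[OF finite])
  case 1
  show ?case using prob_space.emeasure_space_1[OF M] by simp
next
  case (2 b A)
  let ?F = "history M p \<xi> z \<epsilon> b"
  let ?Y = "\<lambda>\<omega>. \<Prod>i\<in>A. exp (g (z i \<omega>) * \<epsilon> i \<omega> - (g (z i \<omega>))\<^sup>2 * \<sigma>\<^sup>2 / 2)"
  obtain B where B: "AE \<omega> in M. \<bar>\<epsilon> b \<omega>\<bar> \<le> B"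
    using noise unfolding bounded_subgaussian_noise_def by blast
  have [measurable]: "z i \<in> borel_measurable ?F" "\<epsilon> i \<in> borel_measurable ?F" if "i \<in> A" for i
    using 2 that history_input[where z = z and \<epsilon> = \<epsilon>, OF meas, of i b] history_noise[where z = z and \<epsilon> = \<epsilon>, OF meas, of i b] by auto
  have [measurable]: "z b \<in> borel_measurable ?F" using history_input[where z = z and \<epsilon> = \<epsilon>, OF meas] by simp
  have "(\<integral>\<^sup>+\<omega>. ennreal (?Y \<omega> * exp (g (z b \<omega>) * \<epsilon> b \<omega> - (g (z b \<omega>))\<^sup>2 * \<sigma>\<^sup>2 / 2)) \<partial>M) \<le> (\<integral>\<^sup>+\<omega>. ennreal (?Y \<omega>) \<partial>M)"
  proof (rule nn_integral_subgaussian_predictable[OF M subalgebra_history[where z = z and \<epsilon> = \<epsilon>, OF meas] meas(3) B])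
    show "AE \<omega> in M. real_cond_exp M ?F (\<lambda>\<omega>. exp (s * \<epsilon> b \<omega>)) \<omega> \<le> exp (s\<^sup>2 * \<sigma>\<^sup>2 / 2)" for s
      using noise by (auto simp: bounded_subgaussian_noise_def)
  qed (measurable, auto intro!: prod_nonneg)
  with 2 show ?case by (subst prod.insert) (auto simp: mult.commute)
qed

subsection \<open>Measurability of linear-algebraic operations\<close>

lemma borel_measurable_vec_nth [measurable (raw)]:
  fixes f :: "'a \<Rightarrow> real^'d"
  assumes "f \<in> borel_measurable M"
  shows "(\<lambda>\<omega>. f \<omega> $ i) \<in> borel_measurable M"
  using borel_measurable_inner[OF assms borel_measurable_const[of "axis i 1"]] by (simp add: inner_axis)

lemma borel_measurable_vecI:
  fixes f :: "'a \<Rightarrow> real^'d"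
  assumes "\<And>i. (\<lambda>\<omega>. f \<omega> $ i) \<in> borel_measurable M"
  shows "f \<in> borel_measurable M"
  by (subst borel_measurable_euclidean_space) (auto simp: Basis_vec_def inner_axis assms)

lemma borel_measurable_det:
  fixes A :: "'a \<Rightarrow> real^'d^'d"
  assumes [measurable]: "\<And>i j. (\<lambda>\<omega>. A \<omega> $ i $ j) \<in> borel_measurable M"
  shows "(\<lambda>\<omega>. det (A \<omega>)) \<in> borel_measurable M"
  unfolding det_def by measurable

lemma borel_measurable_matrix_vector_mult:
  fixes A :: "'a \<Rightarrow> real^'d^'n" and b :: "'a \<Rightarrow> real^'d"
  assumes [measurable]: "\<And>i j. (\<lambda>\<omega>. A \<omega> $ i $ j) \<in> borel_measurable M" "b \<in> borel_measurable M"
  shows "(\<lambda>\<omega>. A \<omega> *v b \<omega>) \<in> borel_measurable M"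
  by (rule borel_measurable_vecI) (simp add: matrix_vector_mult_def)

text \<open>By Cramer's rule every component is a quotient of determinants, which are polynomials in
  the entries.\<close>

lemma borel_measurable_matrix_inv_vector_mult:
  fixes A :: "'a \<Rightarrow> real^'d^'d" and b :: "'a \<Rightarrow> real^'d"
  assumes A[measurable]: "\<And>i j. (\<lambda>\<omega>. A \<omega> $ i $ j) \<in> borel_measurable M"
    and b[measurable]: "b \<in> borel_measurable M" and pd: "\<And>\<omega>. pos_def (A \<omega>)"
  shows "(\<lambda>\<omega>. matrix_inv (A \<omega>) *v b \<omega>) \<in> borel_measurable M"
proof (rule borel_measurable_vecI)
  fix k
  have "(matrix_inv (A \<omega>) *v b \<omega>) $ k = det (\<chi> i j. if j = k then b \<omega> $ i else A \<omega> $ i $ j) / det (A \<omega>)" for \<omega>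
    using cramer_lemma[where A = "A \<omega>" and x = "matrix_inv (A \<omega>) *v b \<omega>" and k = k, unfolded matrix_inv_vector(1)[OF pd]] pos_def_det_pos[OF pd[of \<omega>]]
    by (simp add: field_simps)
  moreover have [measurable]: "(\<lambda>\<omega>. det (\<chi> i j. if j = k then b \<omega> $ i else A \<omega> $ i $ j)) \<in> borel_measurable M"
    by (rule borel_measurable_det) simp
  moreover have [measurable]: "(\<lambda>\<omega>. det (A \<omega>)) \<in> borel_measurable M"
    by (rule borel_measurable_det) simp
  ultimately show "(\<lambda>\<omega>. (matrix_inv (A \<omega>) *v b \<omega>) $ k) \<in> borel_measurable M"
    by (simp only:) measurable
qed

lemma ball_closure_dense:
  assumes "S \<subseteq> closure D" "D \<subseteq> S" "closed {v. P v}"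
  shows "(\<forall>v\<in>S. P v) \<longleftrightarrow> (\<forall>v\<in>D. P v)"
  using closure_minimal[of D "{v. P v}"] assms by blast

text \<open>\<open>min_eig_greatest\<close> writes each superlevel set as a family of conditions
  closed in \<open>x\<close>, so a countable dense set of vectors suffices.\<close>

lemma borel_measurable_min_eig:
  fixes A :: "'a \<Rightarrow> real^'d^'d"
  assumes [measurable]: "\<And>i j. (\<lambda>\<omega>. A \<omega> $ i $ j) \<in> borel_measurable M"
    and sym: "\<And>\<omega>. transpose (A \<omega>) = A \<omega>"
  shows "(\<lambda>\<omega>. min_eig (A \<omega>)) \<in> borel_measurable M"
proof -
  obtain D :: "(real^'d) set" where D: "countable D" "UNIV \<subseteq> closure D"
    using separable[of "UNIV :: (real^'d) set"] by metis
  have "a \<le> min_eig (A \<omega>) \<longleftrightarrow> (\<forall>x\<in>D. a * (x \<bullet> x) \<le> x \<bullet> (A \<omega> *v x))" for a \<omega>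
  proof -
    have "closed {x. a * (x \<bullet> x) \<le> x \<bullet> (A \<omega> *v x)}"
      by (intro closed_Collect_le continuous_intros matrix_vector_mult_linear_continuous_on)
    then show ?thesis
      unfolding min_eig_greatest[OF sym] using ball_closure_dense[OF D(2)] by blast
  qed
  moreover have "{\<omega> \<in> space M. \<forall>x\<in>D. a * (x \<bullet> x) \<le> x \<bullet> (A \<omega> *v x)} \<in> sets M" for a
  proof (rule sets.sets_Collect_countable_All'[OF _ D(1)])
    fix x :: "real^'d"
    have [measurable]: "(\<lambda>\<omega>. A \<omega> *v x) \<in> borel_measurable M"
      by (rule borel_measurable_matrix_vector_mult) measurable
    show "{\<omega> \<in> space M. a * (x \<bullet> x) \<le> x \<bullet> (A \<omega> *v x)} \<in> sets M" by measurable
  qed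
  ultimately show ?thesis
    unfolding borel_measurable_iff_ge by simp
qed

subsection \<open>The posterior in Bayesian linear regression\<close>

lemma design_matrix_mult: "design_matrix f z *v v = (\<chi> i. f (z i) \<bullet> v)"
  by (simp add: design_matrix_def matrix_vector_mult_def inner_vec_def)

lemma transpose_design_matrix_mult:
  "transpose (design_matrix f z) *v w = (\<Sum>i\<in>UNIV. w $ i *\<^sub>R f (z i))"
  by (simp add: design_matrix_def matrix_vector_mult_def transpose_def vec_eq_iff mult.commute)

lemma post_precision_mult:
  "post_precision f \<Lambda>\<^sub>0 z *v v = (\<Sum>i\<in>UNIV. (f (z i) \<bullet> v) *\<^sub>R f (z i)) + \<Lambda>\<^sub>0 *v v"
  by (simp add: post_precision_def matrix_vector_mult_add_rdistrib matrix_vector_mul_assoc[symmetric]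
      design_matrix_mult transpose_design_matrix_mult del: transpose_matrix_vector)

lemma post_precision_quadratic:
  "v \<bullet> (post_precision f \<Lambda>\<^sub>0 z *v v) = (\<Sum>i\<in>UNIV. (f (z i) \<bullet> v)\<^sup>2) + v \<bullet> (\<Lambda>\<^sub>0 *v v)"
  by (simp add: post_precision_mult inner_add_right inner_sum_right power2_eq_square inner_commute)

lemma pos_def_post_precision:
  assumes "pos_def \<Lambda>\<^sub>0"
  shows "pos_def (post_precision f \<Lambda>\<^sub>0 z)"
  unfolding pos_def_def
proof (intro conjI allI impI)
  show "transpose (post_precision f \<Lambda>\<^sub>0 z) = post_precision f \<Lambda>\<^sub>0 z"
    using pos_def_symmetric[OF assms]
    by (simp add: post_precision_def transpose_def vec_eq_iff matrix_matrix_mult_def mult.commute)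
  show "0 < v \<bullet> (post_precision f \<Lambda>\<^sub>0 z *v v)" if "v \<noteq> 0" for v
    unfolding post_precision_quadratic using pos_def_pos[OF assms that]
    by (simp add: add_nonneg_pos sum_nonneg)
qed

text \<open>The right-hand side of the normal equations is the posterior precision applied to
  \<open>\<theta>\<close>, plus the noise and the prior mismatch; applying the inverse leaves these
  last two.\<close>

lemma post_mean_error:
  fixes \<theta> :: "real^'d"
  assumes "pos_def \<Lambda>\<^sub>0"
  shows "post_mean f \<Lambda>\<^sub>0 \<theta>\<^sub>0 z (\<lambda>i. \<theta> \<bullet> f (z i) + e i) - \<theta> =
    matrix_inv (post_precision f \<Lambda>\<^sub>0 z) *v ((\<Sum>i\<in>UNIV. e i *\<^sub>R f (z i)) + \<Lambda>\<^sub>0 *v (\<theta>\<^sub>0 - \<theta>))"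
proof -
  let ?L = "post_precision f \<Lambda>\<^sub>0 z"
  have "transpose (design_matrix f z) *v (\<chi> i. \<theta> \<bullet> f (z i) + e i) + \<Lambda>\<^sub>0 *v \<theta>\<^sub>0
    = ((\<Sum>i\<in>UNIV. e i *\<^sub>R f (z i)) + \<Lambda>\<^sub>0 *v (\<theta>\<^sub>0 - \<theta>)) + ?L *v \<theta>"
    by (simp add: transpose_design_matrix_mult post_precision_mult scaleR_add_left sum.distrib
        matrix_vector_mult_diff_distrib inner_commute del: transpose_matrix_vector)
  then show ?thesis
    by (simp add: post_mean_def matrix_vector_right_distrib matrix_inv_vector[OF pos_def_post_precision[OF assms]])
qed

section \<open>Norms weighted by a matrix or by its inverse\<close>

lemma pos_def_Cauchy_Schwarz:
  assumes A: "pos_def A"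
  shows "\<bar>x \<bullet> (A *v y)\<bar> \<le> wnorm A x * wnorm A y"
proof -
  let ?c = "y \<bullet> (A *v y)" and ?d = "x \<bullet> (A *v y)" and ?a = "x \<bullet> (A *v x)"
  have "?d\<^sup>2 \<le> ?a * ?c"
  proof (cases "y = 0")
    case False
    then have c: "?c > 0" by (rule pos_def_pos[OF A])
    \<comment> \<open>This is \<open>x\<close> minus its projection onto \<open>y\<close>,
      multiplied by \<open>?c\<close> to avoid a quotient.\<close>
    have "0 \<le> (?c *\<^sub>R x - ?d *\<^sub>R y) \<bullet> (A *v (?c *\<^sub>R x - ?d *\<^sub>R y))"
      by (rule pos_def_nonneg[OF A])
    also have "\<dots> = ?c * (?a * ?c - ?d\<^sup>2)"
      using inner_symmetric_matrix[OF pos_def_symmetric[OF A], of y x]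
      by (simp add: matrix_vector_mult_diff_distrib matrix_vector_mult_scaleR inner_diff_left inner_diff_right
          power2_eq_square algebra_simps)
    finally show ?thesis using c by (simp add: zero_le_mult_iff)
  qed simp
  then have "sqrt (?d\<^sup>2) \<le> sqrt (?a * ?c)" by (rule real_sqrt_le_mono)
  then show ?thesis by (simp add: wnorm_def real_sqrt_mult)
qed

text \<open>Turns the inverse-weighted norm into an \<open>A\<close>-weighted one, so that
  inequalities for \<open>A\<close> apply directly.\<close>

lemma wnorm_matrix_inv:
  assumes "pos_def A"
  shows "wnorm (matrix_inv A) x = wnorm A (matrix_inv A *v x)"
  by (simp add: wnorm_def matrix_inv_vector[OF assms] inner_commute)

lemma matrix_inv_Cauchy_Schwarz:
  assumes A: "pos_def A"
  shows "\<bar>x \<bullet> (matrix_inv A *v y)\<bar> \<le> wnorm (matrix_inv A) x * wnorm (matrix_inv A) y"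
  using pos_def_Cauchy_Schwarz[OF A, of "matrix_inv A *v y" "matrix_inv A *v x"]
  by (simp add: wnorm_matrix_inv[OF A] matrix_inv_vector[OF A] inner_commute mult.commute)

lemma min_eig_pos:
  assumes A: "pos_def A"
  shows "min_eig A > 0"
proof -
  obtain v l where v: "v \<noteq> 0" "A *v v = l *\<^sub>R v" "\<And>x. l * (x \<bullet> x) \<le> x \<bullet> (A *v x)"
    by (rule rayleigh_min_eigenvector[OF pos_def_symmetric[OF A]]) (rule that)
  have "l * (v \<bullet> v) > 0" using pos_def_pos[OF A v(1)] v(2) by simp
  moreover have "v \<bullet> v > 0" using v(1) by simp
  ultimately have "l > 0" by (simp add: zero_less_mult_iff)
  moreover have "l \<le> min_eig A"
    using v(3) min_eig_greatest[OF pos_def_symmetric[OF A]] by blast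
  ultimately show ?thesis by simp
qed

text \<open>For \<open>y = matrix_inv A *v x\<close> the squared norm is
  \<open>y \<bullet> x\<close>. The eigenvalue bound and Cauchy-Schwarz give
  \<open>min_eig A * norm y \<le> norm x\<close>, and Cauchy-Schwarz once more finishes.\<close>

lemma wnorm_matrix_inv_le:
  assumes A: "pos_def A"
  shows "(wnorm (matrix_inv A) x)\<^sup>2 \<le> (x \<bullet> x) / min_eig A"
proof -
  define y where "y = matrix_inv A *v x"
  have x: "A *v y = x" by (simp add: y_def matrix_inv_vector[OF A])
  note l = min_eig_pos[OF A]
  have 1: "min_eig A * (norm y)\<^sup>2 \<le> y \<bullet> x"
    using min_eig_greatest[OF pos_def_symmetric[OF A], of "min_eig A"] by (metis order_refl dot_square_norm x)
  also have 2: "y \<bullet> x \<le> norm y * norm x" by (rule norm_cauchy_schwarz)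
  finally have "min_eig A * norm y \<le> norm x"
    by (cases "y = 0") (auto simp: power2_eq_square)
  then have "norm y \<le> norm x / min_eig A" using l by (simp add: field_simps)
  then have "norm y * norm x \<le> norm x / min_eig A * norm x" by (rule mult_right_mono) simp
  with 2 have "y \<bullet> x \<le> (x \<bullet> x) / min_eig A" by (simp add: dot_square_norm power2_eq_square)
  moreover have "(wnorm (matrix_inv A) x)\<^sup>2 = y \<bullet> x"
    using pos_def_nonneg[OF A, of y] by (simp add: wnorm_matrix_inv[OF A] y_def[symmetric]) (simp add: wnorm_def x)
  ultimately show ?thesis by simp
qed

text \<open>For \<open>y = A *v x\<close>, Cauchy-Schwarz bounds
  \<open>(y \<bullet> y)\<^sup>2\<close> by the product of the squared weighted norms of
  \<open>y\<close> and \<open>x\<close>; the eigenvalue bound on the first leaves a factor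
  \<open>y \<bullet> y\<close> to cancel.\<close>

lemma norm_mult_pos_def_le:
  assumes A: "pos_def A"
  shows "(A *v x) \<bullet> (A *v x) \<le> max_eig A * (wnorm A x)\<^sup>2"
proof (cases "A *v x = 0")
  case True
  then show ?thesis by (simp add: wnorm_def)
next
  case False
  define y where "y = A *v x"
  have y: "y \<bullet> y > 0" using False by (simp add: y_def)
  have sq: "(wnorm A v)\<^sup>2 = v \<bullet> (A *v v)" for v using pos_def_nonneg[OF A] by (simp add: wnorm_def)
  have "(y \<bullet> y)\<^sup>2 \<le> (wnorm A y * wnorm A x)\<^sup>2"
    using pos_def_Cauchy_Schwarz[OF A, of y x] y by (intro power_mono) (auto simp: y_def)
  also have "\<dots> = (y \<bullet> (A *v y)) * (wnorm A x)\<^sup>2" by (simp add: power_mult_distrib sq)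
  also have "\<dots> \<le> (max_eig A * (y \<bullet> y)) * (wnorm A x)\<^sup>2"
    by (intro mult_right_mono max_eig_upper[OF pos_def_symmetric[OF A]]) simp
  finally have "(y \<bullet> y) * (y \<bullet> y) \<le> (y \<bullet> y) * (max_eig A * (wnorm A x)\<^sup>2)"
    by (simp add: power2_eq_square mult_ac)
  then show ?thesis using y by (simp add: y_def)
qed

subsection \<open>The self-normalised bound\<close>

lemma borel_measurable_post_precision:
  assumes [measurable]: "f \<in> borel_measurable borel" "\<And>i. z i \<in> borel_measurable M"
  shows "(\<lambda>\<omega>. post_precision f \<Lambda>\<^sub>0 (\<lambda>i. z i \<omega>) $ i $ j) \<in> borel_measurable M"
proof -
  have [measurable]: "(\<lambda>\<omega>. f (z k \<omega>)) \<in> borel_measurable M" for k by measurable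
  show ?thesis
    by (simp add: post_precision_def matrix_matrix_mult_def transpose_def design_matrix_def)
qed

text \<open>The integrand is a ratio of two Gaussian integrals: the mixture of the exponentials,
  with precision \<open>L\<close>, over the mass of the mixing weight, with precision
  \<open>\<Lambda>\<^sub>0\<close>.\<close>

theorem self_normalized_bound:
  fixes z :: "'n::{finite,linorder} \<Rightarrow> 'a \<Rightarrow> real^2" and f :: "real^2 \<Rightarrow> real^'d"
  assumes M: "prob_space M"
    and meas: "\<xi> \<in> measurable M p" "\<And>i. z i \<in> borel_measurable M" "\<And>i. \<epsilon> i \<in> borel_measurable M"
    and noise: "bounded_subgaussian_noise M p \<xi> z \<epsilon> \<sigma>"
    and f[measurable]: "f \<in> borel_measurable borel"
    and \<sigma>: "\<sigma> > 0" and A: "pos_def \<Lambda>\<^sub>0"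
  defines "S \<equiv> \<lambda>\<omega>. \<Sum>i\<in>UNIV. \<epsilon> i \<omega> *\<^sub>R f (z i \<omega>)" and "L \<equiv> \<lambda>\<omega>. post_precision f \<Lambda>\<^sub>0 (\<lambda>i. z i \<omega>)"
  shows "(\<integral>\<^sup>+\<omega>. ennreal (exp (S \<omega> \<bullet> (matrix_inv (L \<omega>) *v S \<omega>) / (2 * \<sigma>\<^sup>2)) * sqrt (det \<Lambda>\<^sub>0) / sqrt (det (L \<omega>))) \<partial>M) \<le> 1"
proof -
  note [measurable] = meas
  interpret prob_space M by fact
  interpret pair_sigma_finite "lborel :: (real^'d) measure" M by standard
  let ?C = "gauss_const TYPE('d)"
  let ?u = "\<lambda>\<omega>. exp (S \<omega> \<bullet> (matrix_inv (L \<omega>) *v S \<omega>) / (2 * \<sigma>\<^sup>2))"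
  have fz[measurable]: "(\<lambda>\<omega>. f (z i \<omega>)) \<in> borel_measurable M" for i by measurable
  have [measurable]: "S \<in> borel_measurable M" unfolding S_def by measurable
  have L: "pos_def (L \<omega>)" for \<omega> unfolding L_def by (rule pos_def_post_precision[OF A])
  have Lm[measurable]: "(\<lambda>\<omega>. L \<omega> $ i $ j) \<in> borel_measurable M" for i j
    unfolding L_def by (rule borel_measurable_post_precision) measurable
  have [measurable]: "(\<lambda>\<omega>. matrix_inv (L \<omega>) *v S \<omega>) \<in> borel_measurable M"
    by (rule borel_measurable_matrix_inv_vector_mult[OF Lm _ L]) measurable
  have [measurable]: "(\<lambda>\<omega>. det (L \<omega>)) \<in> borel_measurable M"
    by (rule borel_measurable_det) measurable
  \<comment> \<open>\<open>D\<close> is read in two ways: for fixed \<open>x\<close> as the weight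
    times an exponential of mean at most 1, and for fixed \<open>\<omega>\<close> as a Gaussian
    exponent in \<open>x\<close>, since the squares add up with \<open>\<Lambda>\<^sub>0\<close> to
    the posterior precision.\<close>
  define D where "D x \<omega> = ennreal (exp (- (x \<bullet> (\<Lambda>\<^sub>0 *v x)) / 2) *
    exp (\<Sum>i\<in>UNIV. (x \<bullet> f (z i \<omega>)) / \<sigma> * \<epsilon> i \<omega> - (x \<bullet> f (z i \<omega>))\<^sup>2 / 2))" for x \<omega>
  have D: "D x \<omega> = ennreal (exp (((1 / \<sigma>) *\<^sub>R S \<omega>) \<bullet> x - x \<bullet> (L \<omega> *v x) / 2))" for x \<omega>
    unfolding D_def exp_add[symmetric] L_def post_precision_quadratic
    by (simp add: S_def inner_sum_left inner_sum_right sum_subtractf sum_divide_distrib add_divide_distrib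
        inner_commute[of x] mult.commute)
  have Dm: "case_prod D \<in> borel_measurable (lborel \<Otimes>\<^sub>M M)"
  proof -
    have "continuous_on UNIV (\<lambda>x. x \<bullet> (\<Lambda>\<^sub>0 *v x))"
      by (intro continuous_intros matrix_vector_mult_linear_continuous_on)
    then have [measurable]: "(\<lambda>x. x \<bullet> (\<Lambda>\<^sub>0 *v x)) \<in> borel_measurable borel"
      by (rule borel_measurable_continuous_onI)
    show ?thesis unfolding D_def by measurable
  qed
  have 1: "(\<integral>\<^sup>+\<omega>. D x \<omega> \<partial>M) \<le> ennreal (exp (- (x \<bullet> (\<Lambda>\<^sub>0 *v x)) / 2))" for x
  proof -
    \<comment> \<open>Dividing by \<open>\<sigma>\<close> turns the compensator into
      \<open>(x \<bullet> f u)\<^sup>2 / 2\<close>, free of \<open>\<sigma>\<close> as in the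
      posterior precision.\<close>
    let ?g = "\<lambda>u. (x \<bullet> f u) / \<sigma>"
    have "(\<integral>\<^sup>+\<omega>. D x \<omega> \<partial>M) = (\<integral>\<^sup>+\<omega>. ennreal (exp (- (x \<bullet> (\<Lambda>\<^sub>0 *v x)) / 2)) *
       ennreal (\<Prod>i\<in>UNIV. exp (?g (z i \<omega>) * \<epsilon> i \<omega> - (?g (z i \<omega>))\<^sup>2 * \<sigma>\<^sup>2 / 2)) \<partial>M)"
      unfolding D_def exp_sum[OF finite] using \<sigma> by (simp add: ennreal_mult prod_nonneg power_divide)
    also have "\<dots> = ennreal (exp (- (x \<bullet> (\<Lambda>\<^sub>0 *v x)) / 2)) *
       (\<integral>\<^sup>+\<omega>. ennreal (\<Prod>i\<in>UNIV. exp (?g (z i \<omega>) * \<epsilon> i \<omega> - (?g (z i \<omega>))\<^sup>2 * \<sigma>\<^sup>2 / 2)) \<partial>M)"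
      by (rule nn_integral_cmult) measurable
    also have "\<dots> \<le> ennreal (exp (- (x \<bullet> (\<Lambda>\<^sub>0 *v x)) / 2)) * 1"
      by (intro mult_left_mono nn_integral_prod_subgaussian[OF M meas noise]) simp_all
    finally show ?thesis by simp
  qed
  have 2: "(\<integral>\<^sup>+x. D x \<omega> \<partial>lborel) = ?C * ennreal (?u \<omega> / sqrt (det (L \<omega>)))" for \<omega>
    unfolding D nn_integral_gaussian[OF L]
    by (simp add: matrix_vector_mult_scaleR power2_eq_square mult_ac)
  have "?C * (\<integral>\<^sup>+\<omega>. ennreal (?u \<omega> / sqrt (det (L \<omega>))) \<partial>M) = (\<integral>\<^sup>+\<omega>. (\<integral>\<^sup>+x. D x \<omega> \<partial>lborel) \<partial>M)"
    unfolding 2 by (rule nn_integral_cmult[symmetric]) measurable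
  also have "\<dots> = (\<integral>\<^sup>+x. (\<integral>\<^sup>+\<omega>. D x \<omega> \<partial>M) \<partial>lborel)"
    by (rule Fubini'[OF Dm])
  also have "\<dots> \<le> (\<integral>\<^sup>+x. ennreal (exp (- (x \<bullet> (\<Lambda>\<^sub>0 *v x)) / 2)) \<partial>lborel)"
    by (intro nn_integral_mono 1)
  also have "\<dots> = ?C * ennreal (1 / sqrt (det \<Lambda>\<^sub>0))"
    using nn_integral_gaussian[OF A, of 0] by simp
  \<comment> \<open>The Gaussian constant cancels, being neither 0 nor infinite.\<close>
  finally have "(\<integral>\<^sup>+\<omega>. ennreal (?u \<omega> / sqrt (det (L \<omega>))) \<partial>M) \<le> ennreal (1 / sqrt (det \<Lambda>\<^sub>0))"
    using gauss_const_finite_pos[where 'd = 'd] by (simp add: ennreal_mult_le_mult_iff)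
  then have "ennreal (sqrt (det \<Lambda>\<^sub>0)) * (\<integral>\<^sup>+\<omega>. ennreal (?u \<omega> / sqrt (det (L \<omega>))) \<partial>M)
    \<le> ennreal (sqrt (det \<Lambda>\<^sub>0)) * ennreal (1 / sqrt (det \<Lambda>\<^sub>0))"
    by (rule mult_left_mono) simp
  also have "\<dots> = 1"
    using pos_def_det_pos[OF A] by (subst ennreal_mult[symmetric]) auto
  also have "ennreal (sqrt (det \<Lambda>\<^sub>0)) * (\<integral>\<^sup>+\<omega>. ennreal (?u \<omega> / sqrt (det (L \<omega>))) \<partial>M) =
     (\<integral>\<^sup>+\<omega>. ennreal (sqrt (det \<Lambda>\<^sub>0)) * ennreal (?u \<omega> / sqrt (det (L \<omega>))) \<partial>M)"
    by (rule nn_integral_cmult[symmetric]) measurable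
  also have "\<dots> = (\<integral>\<^sup>+\<omega>. ennreal (?u \<omega> * sqrt (det \<Lambda>\<^sub>0) / sqrt (det (L \<omega>))) \<partial>M)"
  proof (rule nn_integral_cong)
    show "ennreal (sqrt (det \<Lambda>\<^sub>0)) * ennreal (?u \<omega> / sqrt (det (L \<omega>))) = ennreal (?u \<omega> * sqrt (det \<Lambda>\<^sub>0) / sqrt (det (L \<omega>)))" for \<omega>
      using pos_def_det_pos[OF A] pos_def_det_pos[OF L, of \<omega>] by (subst ennreal_mult[symmetric]) (auto simp: mult.commute)
  qed
  finally show ?thesis .
qed

text \<open>The deterministic half: off the exceptional events, one term of the radius pays for the
  noise \<open>S\<close> and the other for the prior error \<open>e\<close>.\<close>

lemma confidence_ellipsoid:
  fixes f :: "real^2 \<Rightarrow> real^'d" and z :: "'n::finite \<Rightarrow> real^2" and S e v :: "real^'d" and \<Lambda>\<^sub>0 :: "real^'d^'d"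
  defines "L \<equiv> post_precision f \<Lambda>\<^sub>0 z"
  assumes A: "pos_def \<Lambda>\<^sub>0" and \<sigma>: "\<sigma> > 0" and \<delta>: "\<delta> > 0"
    and noise: "\<delta> * (exp (S \<bullet> (matrix_inv L *v S) / (2 * \<sigma>\<^sup>2)) * sqrt (det \<Lambda>\<^sub>0) / sqrt (det L)) < 1"
    and prior: "(wnorm \<Lambda>\<^sub>0 e)\<^sup>2 \<le> \<sigma>\<^sup>2 * quantile (chi_squared CARD('d)) (1 - \<delta>)"
  shows "\<bar>v \<bullet> (matrix_inv L *v (S + \<Lambda>\<^sub>0 *v e))\<bar> \<le> wnorm (matrix_inv L) v * conf_radius f \<Lambda>\<^sub>0 \<sigma> \<delta> z"
proof -
  have L: "pos_def L" unfolding L_def by (rule pos_def_post_precision[OF A])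
  let ?q = "quantile (chi_squared CARD('d)) (1 - \<delta>)"
  let ?r = "1 / \<delta> * (sqrt (det L) / sqrt (det \<Lambda>\<^sub>0))"
  let ?Q = "S \<bullet> (matrix_inv L *v S)"
  have nn: "wnorm (matrix_inv L) x \<ge> 0" for x
    using pos_def_nonneg[OF L] by (simp add: wnorm_matrix_inv[OF L]) (simp add: wnorm_def)
  have dets: "det L > 0" "det \<Lambda>\<^sub>0 > 0" using pos_def_det_pos L A by blast+
  \<comment> \<open>The noise hypothesis is solved for the exponential; \<open>?r\<close> is the
    argument of the logarithm in \<open>conf_radius\<close>.\<close>
  have "exp (?Q / (2 * \<sigma>\<^sup>2)) < ?r"
    using noise \<delta> dets by (simp add: field_simps)
  moreover have "?r > 0" using \<delta> dets by simp
  ultimately have "?Q / (2 * \<sigma>\<^sup>2) \<le> ln ?r"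
    by (simp only: ln_ge_iff less_imp_le)
  then have "?Q \<le> \<sigma>\<^sup>2 * (2 * ln ?r)"
    using \<sigma> by (simp add: field_simps)
  then have "sqrt ?Q \<le> sqrt (\<sigma>\<^sup>2 * (2 * ln ?r))" by (rule real_sqrt_le_mono)
  then have 1: "wnorm (matrix_inv L) S \<le> \<sigma> * sqrt (2 * ln ?r)"
    using \<sigma> unfolding wnorm_def by (simp add: real_sqrt_mult)
  \<comment> \<open>Multiplying the prior bound by this eigenvalue needs its sign, which any basis
    vector reveals.\<close>
  have max: "max_eig \<Lambda>\<^sub>0 \<ge> 0"
  proof -
    obtain b :: "real^'d" where "b \<in> Basis" by (meson ex_in_conv nonempty_Basis)
    then have "0 < b \<bullet> (\<Lambda>\<^sub>0 *v b)" "b \<bullet> b = 1" using pos_def_pos[OF A, of b] by (auto simp: nonzero_Basis)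
    then show ?thesis using max_eig_upper[OF pos_def_symmetric[OF A], of b] by simp
  qed
  \<comment> \<open>Passing to the Euclidean norm costs \<open>1 / min_eig L\<close> and passing on
    to the \<open>\<Lambda>\<^sub>0\<close>-norm costs \<open>max_eig \<Lambda>\<^sub>0\<close>:
    hence the eigenvalue ratio in the radius.\<close>
  have "(wnorm (matrix_inv L) (\<Lambda>\<^sub>0 *v e))\<^sup>2 \<le> ((\<Lambda>\<^sub>0 *v e) \<bullet> (\<Lambda>\<^sub>0 *v e)) / min_eig L"
    by (rule wnorm_matrix_inv_le[OF L])
  also have "\<dots> \<le> max_eig \<Lambda>\<^sub>0 * (\<sigma>\<^sup>2 * ?q) / min_eig L"
    using min_eig_pos[OF L] norm_mult_pos_def_le[OF A, of e] mult_left_mono[OF prior max]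
    by (intro divide_right_mono) auto
  also have "\<dots> = \<sigma>\<^sup>2 * (max_eig \<Lambda>\<^sub>0 / min_eig L * ?q)" by simp
  finally have "sqrt ((wnorm (matrix_inv L) (\<Lambda>\<^sub>0 *v e))\<^sup>2) \<le> sqrt (\<sigma>\<^sup>2 * (max_eig \<Lambda>\<^sub>0 / min_eig L * ?q))"
    by (rule real_sqrt_le_mono)
  then have 2: "wnorm (matrix_inv L) (\<Lambda>\<^sub>0 *v e) \<le> \<sigma> * sqrt (max_eig \<Lambda>\<^sub>0 / min_eig L * ?q)"
    using \<sigma> nn[of "\<Lambda>\<^sub>0 *v e"]
    by (simp only: real_sqrt_mult[of "\<sigma>\<^sup>2"] real_sqrt_abs abs_of_nonneg abs_of_pos)
  have "\<bar>v \<bullet> (matrix_inv L *v (S + \<Lambda>\<^sub>0 *v e))\<bar> \<le> \<bar>v \<bullet> (matrix_inv L *v S)\<bar> + \<bar>v \<bullet> (matrix_inv L *v (\<Lambda>\<^sub>0 *v e))\<bar>"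
    by (simp add: matrix_vector_right_distrib inner_add_right)
  also have "\<dots> \<le> wnorm (matrix_inv L) v * wnorm (matrix_inv L) S + wnorm (matrix_inv L) v * wnorm (matrix_inv L) (\<Lambda>\<^sub>0 *v e)"
    by (intro add_mono matrix_inv_Cauchy_Schwarz[OF L])
  also have "\<dots> \<le> wnorm (matrix_inv L) v * (\<sigma> * sqrt (2 * ln ?r)) + wnorm (matrix_inv L) v * (\<sigma> * sqrt (max_eig \<Lambda>\<^sub>0 / min_eig L * ?q))"
    by (intro add_mono mult_left_mono 1 2 nn)
  also have "\<dots> = wnorm (matrix_inv L) v * conf_radius f \<Lambda>\<^sub>0 \<sigma> \<delta> z"
    by (simp add: conf_radius_def L_def algebra_simps)
  finally show ?thesis .
qed

section \<open>Probability of the confidence event\<close>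

theorem theorem3:
  fixes M :: "'a measure"
    and p :: "'e measure"
    and \<xi> :: "'a \<Rightarrow> 'e"
    and obstacle :: "'e \<Rightarrow> (real^2) set"
    and \<phi> :: "'w \<Rightarrow> real^2 \<Rightarrow> real^'d"
    and w :: 'w
    and \<theta>\<^sub>0 :: "real^'d"
    and \<Lambda>\<^sub>0 :: "real^'d^'d"
    and \<theta>star :: "'e \<Rightarrow> real^'d"
    and z :: "'n::{finite,linorder} \<Rightarrow> 'a \<Rightarrow> real^2"
    and y \<epsilon> :: "'n \<Rightarrow> 'a \<Rightarrow> real"
    and \<sigma> \<delta> :: real
  assumes "prob_space M"
    and "\<xi> \<in> measurable M p" and "distr M p \<xi> = p"
    and "\<And>x. x \<in> space p \<Longrightarrow> surface (obstacle x) \<noteq> {}"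
    and "\<phi> w \<in> borel_measurable borel"
    and "\<sigma> > 0" and "0 < \<delta>" and "\<delta> < 1"
    and "pos_def \<Lambda>\<^sub>0"
    and "\<And>i. z i \<in> borel_measurable M" and "\<And>i. \<epsilon> i \<in> borel_measurable M"
    and noise: "bounded_subgaussian_noise M p \<xi> z \<epsilon> \<sigma>"
    and data: "\<And>i \<omega>. \<omega> \<in> space M \<Longrightarrow> y i \<omega> = h_IS (obstacle (\<xi> \<omega>)) (z i \<omega>) + \<epsilon> i \<omega>"
    and "\<theta>star \<in> borel_measurable p"
    and assumption1: "\<And>x u. x \<in> space p \<Longrightarrow> \<theta>star x \<bullet> \<phi> w u = h_IS (obstacle x) u"
    and assumption2: "measure p {x \<in> space p. (wnorm \<Lambda>\<^sub>0 (\<theta>star x - \<theta>\<^sub>0))\<^sup>2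
                        \<le> \<sigma>\<^sup>2 * quantile (chi_squared CARD('d)) (1 - \<delta>)} \<ge> 1 - \<delta>"
  defines "\<Lambda> \<equiv> \<lambda>\<omega>. post_precision (\<phi> w) \<Lambda>\<^sub>0 (\<lambda>i. z i \<omega>)"
    and "\<theta> \<equiv> \<lambda>\<omega>. post_mean (\<phi> w) \<Lambda>\<^sub>0 \<theta>\<^sub>0 (\<lambda>i. z i \<omega>) (\<lambda>i. y i \<omega>)"
    and "\<beta> \<equiv> \<lambda>\<omega>. conf_radius (\<phi> w) \<Lambda>\<^sub>0 \<sigma> \<delta> (\<lambda>i. z i \<omega>)"
  shows "measure M {\<omega> \<in> space M. \<forall>u.
            \<bar>h_IS (obstacle (\<xi> \<omega>)) u - mean_prediction (\<phi> w) (\<theta> \<omega>) u\<bar>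
              \<le> \<bar>\<phi> w u \<bullet> (\<theta> \<omega> - \<theta>star (\<xi> \<omega>))\<bar>
          \<and> \<bar>\<phi> w u \<bullet> (\<theta> \<omega> - \<theta>star (\<xi> \<omega>))\<bar>
              \<le> wnorm (matrix_inv (\<Lambda> \<omega>)) (\<phi> w u) * \<beta> \<omega>}
         \<ge> 1 - 2 * \<delta>"
proof -
  note meas = assms(2) assms(10) assms(11)
  note [measurable] = assms(2) assms(5) assms(10) assms(11) assms(14)
  note A = \<open>pos_def \<Lambda>\<^sub>0\<close>
  interpret prob_space M by fact
  define f where "f = \<phi> w"
  define S where "S \<omega> = (\<Sum>i\<in>UNIV. \<epsilon> i \<omega> *\<^sub>R f (z i \<omega>))" for \<omega>
  define e where "e \<omega> = \<theta>\<^sub>0 - \<theta>star (\<xi> \<omega>)" for \<omega>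
  define c where "c \<omega> = matrix_inv (\<Lambda> \<omega>) *v (S \<omega> + \<Lambda>\<^sub>0 *v e \<omega>)" for \<omega>
  let ?q = "quantile (chi_squared CARD('d)) (1 - \<delta>)"
  let ?u = "\<lambda>\<omega>. exp (S \<omega> \<bullet> (matrix_inv (\<Lambda> \<omega>) *v S \<omega>) / (2 * \<sigma>\<^sup>2)) * sqrt (det \<Lambda>\<^sub>0) / sqrt (det (\<Lambda> \<omega>))"
  have f[measurable]: "f \<in> borel_measurable borel" unfolding f_def by fact
  have \<Lambda>: "pos_def (\<Lambda> \<omega>)" for \<omega> unfolding \<Lambda>_def by (rule pos_def_post_precision[OF A])
  have [measurable]: "(\<lambda>\<omega>. f (z i \<omega>)) \<in> borel_measurable M" for i by measurable
  have [measurable]: "S \<in> borel_measurable M" unfolding S_def by measurable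
  have [measurable]: "e \<in> borel_measurable M" unfolding e_def by measurable
  have [measurable]: "(\<lambda>\<omega>. \<Lambda>\<^sub>0 *v e \<omega>) \<in> borel_measurable M"
    by (rule borel_measurable_matrix_vector_mult) measurable
  have \<Lambda>m[measurable]: "(\<lambda>\<omega>. \<Lambda> \<omega> $ i $ j) \<in> borel_measurable M" for i j
    unfolding \<Lambda>_def f_def[symmetric] by (rule borel_measurable_post_precision) measurable
  have inv[measurable]: "(\<lambda>\<omega>. matrix_inv (\<Lambda> \<omega>) *v b \<omega>) \<in> borel_measurable M"
    if "b \<in> borel_measurable M" for b
    by (rule borel_measurable_matrix_inv_vector_mult[OF \<Lambda>m that \<Lambda>])
  have [measurable]: "c \<in> borel_measurable M" unfolding c_def by measurable
  have det[measurable]: "(\<lambda>\<omega>. det (\<Lambda> \<omega>)) \<in> borel_measurable M"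
    by (rule borel_measurable_det) measurable
  have mineig: "(\<lambda>\<omega>. min_eig (\<Lambda> \<omega>)) \<in> borel_measurable M"
    by (rule borel_measurable_min_eig[OF \<Lambda>m pos_def_symmetric[OF \<Lambda>]])
  have \<beta>[measurable]: "\<beta> \<in> borel_measurable M"
    using det mineig unfolding \<beta>_def conf_radius_def \<Lambda>_def by measurable

  \<comment> \<open>Assumption 1 makes the data an exact linear regression with parameter
    \<open>\<theta>star (\<xi> \<omega>)\<close>.\<close>
  have error: "\<theta> \<omega> - \<theta>star (\<xi> \<omega>) = c \<omega>" if "\<omega> \<in> space M" for \<omega>
  proof -
    have "\<xi> \<omega> \<in> space p" using measurable_space[OF assms(2) that] .
    then have y: "(\<lambda>i. y i \<omega>) = (\<lambda>i. \<theta>star (\<xi> \<omega>) \<bullet> f (z i \<omega>) + \<epsilon> i \<omega>)"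
      by (simp add: data[OF that] assumption1 f_def)
    show ?thesis
      unfolding \<theta>_def c_def \<Lambda>_def S_def e_def f_def[symmetric] y by (rule post_mean_error[OF A])
  qed
  let ?P = "\<lambda>\<omega> v. \<bar>v \<bullet> c \<omega>\<bar> \<le> wnorm (matrix_inv (\<Lambda> \<omega>)) v * \<beta> \<omega>"
  define E where "E = {\<omega> \<in> space M. \<forall>u. \<bar>h_IS (obstacle (\<xi> \<omega>)) u - mean_prediction (\<phi> w) (\<theta> \<omega>) u\<bar>
      \<le> \<bar>\<phi> w u \<bullet> (\<theta> \<omega> - \<theta>star (\<xi> \<omega>))\<bar>
    \<and> \<bar>\<phi> w u \<bullet> (\<theta> \<omega> - \<theta>star (\<xi> \<omega>))\<bar> \<le> wnorm (matrix_inv (\<Lambda> \<omega>)) (\<phi> w u) * \<beta> \<omega>}"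
  \<comment> \<open>By Assumption 1 the first inequality is an equality, so only the second remains,
    as a condition on the feature vectors.\<close>
  have E: "E = {\<omega> \<in> space M. \<forall>v\<in>range f. ?P \<omega> v}"
  proof -
    have "\<bar>h_IS (obstacle (\<xi> \<omega>)) u - mean_prediction (\<phi> w) (\<theta> \<omega>) u\<bar> = \<bar>\<phi> w u \<bullet> (\<theta> \<omega> - \<theta>star (\<xi> \<omega>))\<bar>"
      if "\<omega> \<in> space M" for \<omega> u
    proof -
      have "h_IS (obstacle (\<xi> \<omega>)) u = \<theta>star (\<xi> \<omega>) \<bullet> \<phi> w u"
        using measurable_space[OF assms(2) that] by (simp add: assumption1)
      then show ?thesis
        by (simp add: mean_prediction_def inner_diff_right inner_commute[of "\<phi> w u"] abs_minus_commute)
    qed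
    then show ?thesis unfolding E_def by (auto simp: error f_def)
  qed

  \<comment> \<open>The event quantifies over uncountably many points; it is measurable because its defining
    inequality is a closed condition on the feature vector, so a countable dense set suffices.\<close>
  obtain D where D: "countable D" "D \<subseteq> range f" "range f \<subseteq> closure D"
    using separable[of "range f"] by metis
  have E_dense: "E = {\<omega> \<in> space M. \<forall>v\<in>D. ?P \<omega> v}"
  proof -
    have "closed {v. ?P \<omega> v}" for \<omega>
      unfolding wnorm_def
      by (intro closed_Collect_le continuous_intros matrix_vector_mult_linear_continuous_on)
    then show ?thesis unfolding E using ball_closure_dense[OF D(3,2)] by blast
  qed
  \<comment> \<open>\<open>measure\<close> is 0 outside \<open>sets M\<close>, so a lower bound on
    the probability of \<open>E\<close> depends on this membership.\<close>
  have E_sets: "E \<in> sets M"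
    unfolding E_dense
  proof (rule sets.sets_Collect_countable_All'[OF _ D(1)])
    fix v :: "real^'d"
    have [measurable]: "(\<lambda>\<omega>. wnorm (matrix_inv (\<Lambda> \<omega>)) v) \<in> borel_measurable M"
      unfolding wnorm_def by measurable
    show "{\<omega> \<in> space M. ?P \<omega> v} \<in> sets M" by measurable
  qed

  \<comment> \<open>The two bad events: Markov's inequality at threshold
    \<open>1 / \<delta>\<close>, in multiplied form, and failure of the prior bound in Assumption
    2.\<close>
  define B1 where "B1 = {\<omega> \<in> space M. 1 \<le> ennreal \<delta> * ennreal (?u \<omega>)}"
  define B2 where "B2 = {\<omega> \<in> space M. \<not> (wnorm \<Lambda>\<^sub>0 (e \<omega>))\<^sup>2 \<le> \<sigma>\<^sup>2 * ?q}"
  have um[measurable]: "?u \<in> borel_measurable M" by measurable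
  have B1_sets[measurable]: "B1 \<in> sets M" unfolding B1_def by measurable
  have [measurable]: "(\<lambda>\<omega>. wnorm \<Lambda>\<^sub>0 (e \<omega>)) \<in> borel_measurable M"
    unfolding wnorm_def by measurable
  have B2_sets[measurable]: "B2 \<in> sets M" unfolding B2_def by measurable

  have "emeasure M B1 \<le> ennreal \<delta> * (\<integral>\<^sup>+\<omega>. ennreal (?u \<omega>) * indicator (space M) \<omega> \<partial>M)"
    unfolding B1_def by (rule nn_integral_Markov_inequality) measurable
  also have "(\<integral>\<^sup>+\<omega>. ennreal (?u \<omega>) * indicator (space M) \<omega> \<partial>M) = (\<integral>\<^sup>+\<omega>. ennreal (?u \<omega>) \<partial>M)"
    by (intro nn_integral_cong) simp
  also have "\<dots> \<le> 1"
    using self_normalized_bound[OF \<open>prob_space M\<close> meas noise f \<open>\<sigma> > 0\<close> A]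
    unfolding S_def \<Lambda>_def f_def .
  finally have "emeasure M B1 \<le> ennreal \<delta>" by (simp add: mult_left_mono)
  then have B1: "prob B1 \<le> \<delta>" using \<open>0 < \<delta>\<close> by (simp add: emeasure_eq_measure)

  have B2: "prob B2 \<le> \<delta>"
  proof -
    let ?G = "{x \<in> space p. (wnorm \<Lambda>\<^sub>0 (\<theta>star x - \<theta>\<^sub>0))\<^sup>2 \<le> \<sigma>\<^sup>2 * ?q}"
    have [measurable]: "(\<lambda>x. \<Lambda>\<^sub>0 *v (\<theta>star x - \<theta>\<^sub>0)) \<in> borel_measurable p"
      by (rule borel_measurable_matrix_vector_mult) measurable
    have G: "?G \<in> sets p" unfolding wnorm_def by measurable
    have "wnorm \<Lambda>\<^sub>0 (e \<omega>) = wnorm \<Lambda>\<^sub>0 (\<theta>star (\<xi> \<omega>) - \<theta>\<^sub>0)" for \<omega>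
      by (simp add: e_def wnorm_def matrix_vector_mult_diff_distrib inner_diff_left inner_diff_right)
    then have "B2 = space M - (\<xi> -` ?G \<inter> space M)"
      using measurable_space[OF assms(2)] by (auto simp: B2_def)
    also have "prob \<dots> = 1 - prob (\<xi> -` ?G \<inter> space M)"
      by (intro prob_compl measurable_sets[OF assms(2) G])
    \<comment> \<open>Assumption 2 concerns \<open>p\<close>; it transfers to \<open>M\<close>
      because \<open>p\<close> is the law of \<open>\<xi>\<close>.\<close>
    also have "prob (\<xi> -` ?G \<inter> space M) = measure p ?G"
      using measure_distr[OF assms(2) G] by (simp only: \<open>distr M p \<xi> = p\<close>)
    finally show ?thesis using assumption2 by simp
  qed

  \<comment> \<open>The bad events do not mention \<open>v\<close>, so outside them the bound holds
    for all vectors at once and only two failure probabilities are added.\<close>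
  have "space M - (B1 \<union> B2) \<subseteq> E"
  proof
    fix \<omega> assume \<omega>: "\<omega> \<in> space M - (B1 \<union> B2)"
    have "?u \<omega> \<ge> 0"
      using pos_def_det_pos[OF A] pos_def_det_pos[OF \<Lambda>, of \<omega>] by simp
    then have "\<delta> * ?u \<omega> < 1"
      using \<omega> \<open>0 < \<delta>\<close> by (simp add: B1_def not_le ennreal_mult[symmetric] ennreal_less_one_iff)
    moreover have "(wnorm \<Lambda>\<^sub>0 (e \<omega>))\<^sup>2 \<le> \<sigma>\<^sup>2 * ?q" using \<omega> by (simp add: B2_def)
    ultimately have "?P \<omega> v" for v
      unfolding c_def \<beta>_def \<Lambda>_def
      by (rule confidence_ellipsoid[OF A \<open>\<sigma> > 0\<close> \<open>0 < \<delta>\<close>])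
    then show "\<omega> \<in> E" using \<omega> unfolding E by simp
  qed
  then have "prob (space M - (B1 \<union> B2)) \<le> prob E"
    by (rule finite_measure_mono[OF _ E_sets])
  moreover have "prob (space M - (B1 \<union> B2)) = 1 - prob (B1 \<union> B2)"
    by (rule prob_compl) measurable
  moreover have "prob (B1 \<union> B2) \<le> prob B1 + prob B2"
    by (rule measure_Un_le) measurable
  ultimately have "prob E \<ge> 1 - 2 * \<delta>" using B1 B2 by linarith
  then show ?thesis unfolding E_def .
qed

end
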